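(* Let $n\geq 1$ be an integer, let $P(z)=z^{n}+a_{n-2}z^{n-2}+\cdots+a_0$ be a polynomial with constant complex coefficients (for $n=1$ this means $P(z)=z$), let $S(z)$ be a nonzero rational function, and put $h(z)=S(z)e^{P(z)}$. If $f(z)$ is a meromorphic solution of the first order differential equation $f'(z)=h(z)f(z)+1$, then the hyper-order of $f$ satisfies $\varsigma(f)=\sigma(h)=n$.
   Context: For a function $f$ analytic outside some disk centred at the origin, the order of growth is $\sigma(f)=\limsup_{|z|\to\infty}\frac{\log\log|f(z)|}{\log|z|}$, and, if $\sigma(f)=\infty$, the hyper-order is $\varsigma(f)=\limsup_{|z|\to\infty}\frac{\log\log\log|f(z)|}{\log|z|}$ (the limsup being taken over those $z$ for which the iterated logarithms are defined). Since $S$ has finitely many poles, $f$ and $h$ are analytic outside some disk centred at the origin. *)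

theory Defs
  imports "HOL-Complex_Analysis.Complex_Analysis"
begin

(* The fraction is in lowest terms, so the zeros of q are exactly the poles of R;
   there R takes the value 0, by division by zero. *)
definition rational_function :: "(complex \<Rightarrow> complex) \<Rightarrow> bool" where
  "rational_function R \<longleftrightarrow>
     (\<exists>p q :: complex poly. q \<noteq> 0 \<and> coprime p q \<and> (\<forall>z. R z = poly p z / poly q z))"

(* In the next two definitions the limit superior runs only over the points where the
   iterated logarithms make sense; the library's ln is total, so its arguments must be
   required to be positive. *)
definition growth_order :: "(complex \<Rightarrow> complex) \<Rightarrow> ereal" where
  "growth_order f =
     Limsup (inf at_infinity (principal {z. 0 < norm (f z) \<and> 0 < ln (norm (f z))}))
       (\<lambda>z. ereal (ln (ln (norm (f z))) / ln (norm z)))"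

(* Only meaningful when growth_order f = \<infinity>. *)
definition hyper_order :: "(complex \<Rightarrow> complex) \<Rightarrow> ereal" where
  "hyper_order f =
     Limsup (inf at_infinity (principal
         {z. 0 < norm (f z) \<and> 0 < ln (norm (f z)) \<and> 0 < ln (ln (norm (f z)))}))
       (\<lambda>z. ereal (ln (ln (ln (norm (f z)))) / ln (norm z)))"

end

theory Submission
  imports Defs "HOL-Real_Asymp.Real_Asymp"
begin

text \<open>
  The upper bound on the growth of \<open>f\<close> is Gronwall's inequality along rays: the solution is at most
  the exponential of the integral of \<open>|h|\<close>, and \<open>|h|\<close> is at most \<open>exp (|z|\<^sup>c)\<close> for every
  \<open>c > n\<close> (\<open>linear_ode_upper_bound\<close>). The same estimate of \<open>|h|\<close>, and its size on
  the positive reals, give the order of \<open>h\<close>.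

  For the lower bound, the equation is brought to a normal form in which the form \<open>h dz\<close> becomes nearly
  \<open>e\<^sup>\<tau> d\<tau>\<close>. In the coordinate \<open>\<omega> = z\<^sup>n\<close> one has \<open>h dz = exp (L \<omega>) d\<omega>\<close> with \<open>L'\<close> close to 1
  (\<open>logarithmic_coordinate\<close>), so that \<open>L\<close> can be inverted (\<open>near_identity_inverse\<close>) and \<open>\<tau> = L \<omega>\<close>
  taken as coordinate. Up to a slowly varying factor, \<open>f\<close> then satisfies \<open>y' = A e\<^sup>\<tau> y + B\<close>
  on a horizontal half-strip, with \<open>A\<close> and \<open>B\<close> close to 1.

  The model equation \<open>y' = e\<^sup>\<tau> y + 1\<close> is solved by \<open>exp (w)\<close> times a primitive of \<open>exp (- w) / w\<close> with respect to
  \<open>w = e\<^sup>\<tau>\<close>. On each line \<open>Im \<tau> = 2\<pi>k\<close> there is exactly one solution that does not grow like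
  \<open>exp (exp (Re \<tau>))\<close>, and the solutions belonging to two neighbouring lines are different, because the
  primitive changes by \<open>2\<pi>\<i>\<close> around \<open>w = 0\<close>. This survives the perturbation (\<open>strip_growth\<close>),
  so \<open>f\<close> is large on at least one of two such lines. There \<open>Re \<tau>\<close> is comparable to \<open>|z|\<^sup>n\<close>, and so
  \<open>|f|\<close> exceeds \<open>exp (exp (|z|\<^sup>c))\<close> at arbitrarily large \<open>z\<close>, for every \<open>c\<close> between 0 and \<open>n\<close>
  (\<open>linear_ode_frequently_large\<close>).
\<close>

section \<open>Order and hyper-order in terms of growth bounds\<close>

lemma eventually_norm_gt_at_infinity: "\<forall>\<^sub>F z in at_infinity. c < norm (z :: complex)"
  by (rule eventually_at_infinityI[of "c + 1"]) auto

lemma ln_le_iff_le_exp: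
  fixes x y :: real
  assumes "0 < x" shows "ln x \<le> y \<longleftrightarrow> x \<le> exp y"
  using assms by (metis exp_le_cancel_iff exp_ln)

lemma ereal_le_of_real_bounds:
  fixes X :: ereal
  assumes "\<And>c. a < c \<Longrightarrow> X \<le> ereal c"
  shows "X \<le> ereal a"
proof (rule ccontr)
  assume "\<not> X \<le> ereal a"
  then obtain c where "ereal a < ereal c" "ereal c < X"
    using ereal_dense2[of "ereal a" X] by (auto simp: not_le)
  with assms[of c] show False by auto
qed

lemma growth_order_le:
  assumes "\<And>c. a < c \<Longrightarrow> \<forall>\<^sub>F z in at_infinity. norm (f z) \<le> exp (norm z powr c)"
  shows "growth_order f \<le> ereal a"
proof (rule ereal_le_of_real_bounds)
  fix c assume "a < c"
  show "growth_order f \<le> ereal c"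
    unfolding growth_order_def
  proof (rule Limsup_bounded, unfold eventually_inf_principal)
    show "\<forall>\<^sub>F z in at_infinity. z \<in> {z. 0 < norm (f z) \<and> 0 < ln (norm (f z))} \<longrightarrow>
        ereal (ln (ln (norm (f z))) / ln (norm z)) \<le> ereal c"
      using assms[OF \<open>a < c\<close>] eventually_norm_gt_at_infinity[of 1]
    proof eventually_elim
      case (elim z)
      show ?case
      proof
        assume z: "z \<in> {z. 0 < norm (f z) \<and> 0 < ln (norm (f z))}"
        then have "ln (norm (f z)) \<le> norm z powr c"
          using elim(1) by (subst ln_le_iff_le_exp) auto
        then have "ln (ln (norm (f z))) \<le> ln (norm z powr c)"
          using z elim(2) by (subst ln_le_cancel_iff) auto
        then show "ereal (ln (ln (norm (f z))) / ln (norm z)) \<le> ereal c"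
          using elim(2) ln_gt_zero[OF elim(2)] by (simp add: ln_powr divide_le_eq)
      qed
    qed
  qed
qed

lemma hyper_order_le:
  assumes "\<And>c. a < c \<Longrightarrow> \<forall>\<^sub>F z in at_infinity. norm (f z) \<le> exp (exp (norm z powr c))"
  shows "hyper_order f \<le> ereal a"
proof (rule ereal_le_of_real_bounds)
  fix c assume "a < c"
  show "hyper_order f \<le> ereal c"
    unfolding hyper_order_def
  proof (rule Limsup_bounded, unfold eventually_inf_principal)
    show "\<forall>\<^sub>F z in at_infinity. z \<in> {z. 0 < norm (f z) \<and> 0 < ln (norm (f z)) \<and> 0 < ln (ln (norm (f z)))} \<longrightarrow>
        ereal (ln (ln (ln (norm (f z)))) / ln (norm z)) \<le> ereal c"
      using assms[OF \<open>a < c\<close>] eventually_norm_gt_at_infinity[of 1]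
    proof eventually_elim
      case (elim z)
      show ?case
      proof
        assume z: "z \<in> {z. 0 < norm (f z) \<and> 0 < ln (norm (f z)) \<and> 0 < ln (ln (norm (f z)))}"
        then have "ln (norm (f z)) \<le> exp (norm z powr c)"
          using elim(1) by (subst ln_le_iff_le_exp) auto
        then have "ln (ln (norm (f z))) \<le> norm z powr c"
          using z by (subst ln_le_iff_le_exp) auto
        then have "ln (ln (ln (norm (f z)))) \<le> ln (norm z powr c)"
          using z elim(2) by (subst ln_le_cancel_iff) auto
        then show "ereal (ln (ln (ln (norm (f z)))) / ln (norm z)) \<le> ereal c"
          using elim(2) ln_gt_zero[OF elim(2)] by (simp add: ln_powr divide_le_eq)
      qed
    qed
  qed
qed

text \<open>
  At points where the iterated logarithms are undefined the function is bounded by a constant,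
  so a bound on the limit superior still bounds the function on a whole neighbourhood of infinity.
\<close>

lemma growth_order_less_imp_bound:
  assumes "growth_order f < ereal c"
  shows "\<forall>\<^sub>F z in at_infinity. norm (f z) \<le> exp (norm z powr c)"
  using Limsup_lessD[OF assms[unfolded growth_order_def], unfolded eventually_inf_principal]
    eventually_norm_gt_at_infinity[of 1]
proof eventually_elim
  case (elim z)
  show ?case
  proof (cases "0 < norm (f z) \<and> 0 < ln (norm (f z))")
    case True
    then have "ln (ln (norm (f z))) \<le> c * ln (norm z)"
      using elim ln_gt_zero[OF elim(2)] by (simp add: divide_less_eq)
    then have "ln (norm (f z)) \<le> norm z powr c"
      using True elim(2) by (subst (asm) ln_le_iff_le_exp) (auto simp: powr_def)
    then show ?thesis
      using True by (subst (asm) ln_le_iff_le_exp) auto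
  next
    case False
    then have "norm (f z) \<le> 1" by (metis linorder_not_le ln_gt_zero zero_less_one less_trans)
    also have "1 \<le> exp (norm z powr c)" by simp
    finally show ?thesis .
  qed
qed

lemma hyper_order_less_imp_bound:
  assumes "hyper_order f < ereal c"
  shows "\<forall>\<^sub>F z in at_infinity. norm (f z) \<le> exp (exp (norm z powr c))"
  using Limsup_lessD[OF assms[unfolded hyper_order_def], unfolded eventually_inf_principal]
    eventually_norm_gt_at_infinity[of 1]
proof eventually_elim
  case (elim z)
  show ?case
  proof (cases "0 < norm (f z) \<and> 0 < ln (norm (f z)) \<and> 0 < ln (ln (norm (f z)))")
    case True
    then have "ln (ln (ln (norm (f z)))) \<le> c * ln (norm z)"
      using elim ln_gt_zero[OF elim(2)] by (simp add: divide_less_eq)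
    then have "ln (ln (norm (f z))) \<le> norm z powr c"
      using True elim(2) by (subst (asm) ln_le_iff_le_exp) (auto simp: powr_def)
    then have "ln (norm (f z)) \<le> exp (norm z powr c)"
      using True by (subst (asm) ln_le_iff_le_exp) auto
    then show ?thesis
      using True by (subst (asm) ln_le_iff_le_exp) auto
  next
    case False
    have "norm (f z) \<le> exp 1"
    proof (rule ccontr)
      assume "\<not> norm (f z) \<le> exp 1"
      then have "exp 1 < norm (f z)" by simp
      moreover from this have "0 < norm (f z)" using exp_gt_zero less_trans by blast
      ultimately have "1 < ln (norm (f z))" "0 < norm (f z)"
        using ln_less_cancel_iff[of "exp 1" "norm (f z)"] by simp_all
      then have "0 < ln (norm (f z))" "0 < ln (ln (norm (f z)))"
        by (simp_all only: ln_gt_zero order_less_trans[OF zero_less_one])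
      with \<open>0 < norm (f z)\<close> show False using False by blast
    qed
    also have "exp 1 \<le> exp (exp (norm z powr c))" by simp
    finally show ?thesis .
  qed
qed

lemma growth_order_ge:
  assumes "0 < a" "\<And>c. 0 < c \<Longrightarrow> c < a \<Longrightarrow> \<exists>\<^sub>F z in at_infinity. exp (norm z powr c) < norm (f z)"
  shows "ereal a \<le> growth_order f"
proof (rule ccontr)
  assume "\<not> ereal a \<le> growth_order f"
  then obtain c where c: "max 0 (growth_order f) < ereal c" "ereal c < ereal a"
    using ereal_dense2[of "max 0 (growth_order f)" "ereal a"] \<open>0 < a\<close> by (auto simp: not_le)
  then have "\<forall>\<^sub>F z in at_infinity. norm (f z) \<le> exp (norm z powr c)"
    by (intro growth_order_less_imp_bound) auto
  then show False
    using assms(2)[of c] c by (simp add: frequently_def not_less)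
qed

lemma hyper_order_ge:
  assumes "0 < a" "\<And>c. 0 < c \<Longrightarrow> c < a \<Longrightarrow> \<exists>\<^sub>F z in at_infinity. exp (exp (norm z powr c)) < norm (f z)"
  shows "ereal a \<le> hyper_order f"
proof (rule ccontr)
  assume "\<not> ereal a \<le> hyper_order f"
  then obtain c where c: "max 0 (hyper_order f) < ereal c" "ereal c < ereal a"
    using ereal_dense2[of "max 0 (hyper_order f)" "ereal a"] \<open>0 < a\<close> by (auto simp: not_le)
  then have "\<forall>\<^sub>F z in at_infinity. norm (f z) \<le> exp (exp (norm z powr c))"
    by (intro hyper_order_less_imp_bound) auto
  then show False
    using assms(2)[of c] c by (simp add: frequently_def not_less)
qed

lemma growth_order_eq_infinity:
  assumes "0 < c" "\<exists>\<^sub>F z in at_infinity. exp (exp (norm z powr c)) < norm (f z)"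
  shows "growth_order f = \<infinity>"
proof (rule ccontr)
  assume "growth_order f \<noteq> \<infinity>"
  then have "max 0 (growth_order f) < \<infinity>" by (simp add: max_def)
  then obtain d where d: "max 0 (growth_order f) < ereal d"
    using ereal_dense2 by blast
  then have "\<forall>\<^sub>F z in at_infinity. norm (f z) \<le> exp (norm z powr d)"
    by (intro growth_order_less_imp_bound) auto
  moreover have "0 < d" using d by auto
  have "\<forall>\<^sub>F x in at_top. x powr d \<le> exp (x powr c)"
    using \<open>0 < c\<close> \<open>0 < d\<close> by real_asymp
  then have "\<forall>\<^sub>F z::complex in at_infinity. norm z powr d \<le> exp (norm z powr c)"
    by (rule eventually_compose_filterlim[OF _ filterlim_norm_at_top])
  ultimately have "\<forall>\<^sub>F z in at_infinity. norm (f z) \<le> exp (exp (norm z powr c))"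
    by eventually_elim (meson exp_le_cancel_iff order_trans)
  then show False
    using assms(2) by (simp add: frequently_def not_less)
qed

section \<open>Upper bounds for solutions of linear equations\<close>

text \<open>
  Gronwall's inequality in the form \<open>|u'| \<le> C (|u| + 1)\<close>. The norm itself need not be
  differentiable at zeros of \<open>u\<close>, so the proof shows that \<open>(1 + |u|\<^sup>2) exp (- 4 C x)\<close> is
  nonincreasing; this is where the factor 2 in the exponent comes from.
\<close>

lemma gronwall_norm:
  fixes u :: "real \<Rightarrow> complex"
  assumes "a \<le> b" "0 \<le> C"
    and du: "\<And>x. a \<le> x \<Longrightarrow> x \<le> b \<Longrightarrow> (u has_vector_derivative u' x) (at x)"
    and bd: "\<And>x. a \<le> x \<Longrightarrow> x \<le> b \<Longrightarrow> norm (u' x) \<le> C * (norm (u x) + 1)"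
  shows "norm (u b) \<le> (norm (u a) + 1) * exp (2 * C * (b - a))"
proof -
  define \<phi> where "\<phi> x = (1 + u x \<bullet> u x) * exp (- (4 * C * x))" for x
  define \<phi>' where "\<phi>' x = (u x \<bullet> u' x + u' x \<bullet> u x) * exp (- (4 * C * x)) 
    + (1 + u x \<bullet> u x) * (exp (- (4 * C * x)) * - (4 * C))" for x
  have "\<phi> b \<le> \<phi> a"
  proof (rule DERIV_nonpos_imp_nonincreasing[OF \<open>a \<le> b\<close>])
    fix x assume x: "a \<le> x" "x \<le> b"
    have "((\<lambda>x. u x \<bullet> u x) has_real_derivative (u x \<bullet> u' x + u' x \<bullet> u x)) (at x)"
      using bounded_bilinear.has_vector_derivative[OF bounded_bilinear_inner du[OF x] du[OF x]]
      by (simp add: has_real_derivative_iff_has_vector_derivative)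
    then have D: "(\<phi> has_real_derivative \<phi>' x) (at x)"
      unfolding \<phi>_def \<phi>'_def by (auto intro!: derivative_eq_intros)
    have "u x \<bullet> u' x \<le> norm (u x) * norm (u' x)"
      by (rule norm_cauchy_schwarz)
    also have "\<dots> \<le> norm (u x) * (C * (norm (u x) + 1))"
      using bd[OF x] by (intro mult_left_mono) auto
    also have "\<dots> = C * (norm (u x) ^ 2 + norm (u x))"
      by (simp add: power2_eq_square algebra_simps)
    also have "\<dots> \<le> C * (2 * (1 + u x \<bullet> u x))"
    proof (rule mult_left_mono[OF _ \<open>0 \<le> C\<close>])
      have "0 \<le> (norm (u x) - 1)^2 + 1" by simp
      then show "norm (u x) ^ 2 + norm (u x) \<le> 2 * (1 + u x \<bullet> u x)"
        by (simp add: power2_norm_eq_inner [symmetric] power2_eq_square algebra_simps)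
           (smt (verit) norm_ge_zero)
    qed
    finally have "u x \<bullet> u' x \<le> C * (2 * (1 + u x \<bullet> u x))" .
    then have le: "(u x \<bullet> u' x + u' x \<bullet> u x) - (1 + u x \<bullet> u x) * (4 * C) \<le> 0"
      by (simp add: inner_commute algebra_simps)
    have "\<phi>' x = ((u x \<bullet> u' x + u' x \<bullet> u x) - (1 + u x \<bullet> u x) * (4 * C)) * exp (- (4 * C * x))"
      by (simp add: \<phi>'_def algebra_simps)
    also have "\<dots> \<le> 0"
      by (intro mult_nonpos_nonneg[OF le]) simp
    finally show "\<exists>y. (\<phi> has_real_derivative y) (at x) \<and> y \<le> 0" using D by blast
  qed
  then have "(1 + u b \<bullet> u b) \<le> (1 + u a \<bullet> u a) * (exp (- (4 * C * a)) * exp (4 * C * b))"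
    by (simp add: \<phi>_def exp_minus field_simps)
  also have "exp (- (4 * C * a)) * exp (4 * C * b) = exp (2 * C * (b - a)) ^ 2"
    by (simp add: exp_add[symmetric] exp_of_nat_mult[symmetric] algebra_simps)
  also have "(1 + u a \<bullet> u a) * exp (2 * C * (b - a)) ^ 2
      \<le> ((norm (u a) + 1) * exp (2 * C * (b - a))) ^ 2"
    unfolding power_mult_distrib
    by (intro mult_right_mono) (auto simp: power2_norm_eq_inner[symmetric] power2_eq_square algebra_simps)
  finally have "norm (u b) ^ 2 \<le> ((norm (u a) + 1) * exp (2 * C * (b - a))) ^ 2"
    by (simp add: power2_norm_eq_inner)
  then show ?thesis by (rule power2_le_imp_le) auto
qed

text \<open>
  Along a segment ending at \<open>z\<close> Gronwall's inequality keeps \<open>f\<close> bounded.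
\<close>

lemma linear_ode_bounded_coeff_no_pole:
  fixes f h :: "complex \<Rightarrow> complex"
  assumes h: "isCont h z"
    and ode: "\<forall>\<^sub>F w in at z. (f has_field_derivative h w * f w + 1) (at w)"
  shows "\<not> is_pole f z"
proof
  assume pole: "is_pole f z"
  define C where "C = norm (h z) + 1"
  have "\<forall>\<^sub>F w in at z. norm (h w) < C"
    using h unfolding isCont_def C_def by (intro order_tendstoD(2)[OF tendsto_norm]) auto
  with ode have "\<forall>\<^sub>F w in at z. (f has_field_derivative h w * f w + 1) (at w) \<and> norm (h w) < C"
    by eventually_elim simp
  then obtain r where "0 < r" and r: "\<And>w. w \<noteq> z \<Longrightarrow> dist w z < r \<Longrightarrow>
      (f has_field_derivative h w * f w + 1) (at w) \<and> norm (h w) < C"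
    unfolding eventually_at by blast
  have "0 < C" by (simp add: C_def add_nonneg_pos)
  define u where "u t = f (z + of_real (r/2 - t))" for t
  define M where "M = (norm (u 0) + 1) * exp (2 * (C + 1) * (r/2))"
  have bound: "norm (u t) \<le> M" if t: "0 \<le> t" "t < r/2" for t
  proof -
    have "norm (u t) \<le> (norm (u 0) + 1) * exp (2 * (C + 1) * (t - 0))"
    proof (rule gronwall_norm[OF t(1)])
      fix x assume x: "0 \<le> x" "x \<le> t"
      let ?w = "z + of_real (r/2 - x)"
      have "dist ?w z < r" "?w \<noteq> z"
        using x t \<open>0 < r\<close> by (auto simp: dist_norm simp del: of_real_diff)
      note w = r[OF this(2,1)]
      have "((\<lambda>t. z + of_real (r/2 - t)) has_vector_derivative -1) (at x)"
        by (auto intro!: derivative_eq_intros)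
      from field_vector_diff_chain_at[OF this conjunct1[OF w]]
      show "(u has_vector_derivative - 1 * (h ?w * f ?w + 1)) (at x)"
        by (simp add: u_def[abs_def] o_def)
      have "norm (- 1 * (h ?w * f ?w + 1)) \<le> norm (h ?w) * norm (u x) + 1"
        unfolding u_def using norm_triangle_ineq[of "h ?w * f ?w" 1]
        by (simp only: norm_mult norm_minus_cancel norm_one mult_1_left)
      also have "\<dots> \<le> C * norm (u x) + 1"
        using w by (intro add_mono mult_right_mono) auto
      also have "\<dots> \<le> (C + 1) * (norm (u x) + 1)"
        using \<open>0 < C\<close> by (simp add: algebra_simps)
      finally show "norm (- 1 * (h ?w * f ?w + 1)) \<le> (C + 1) * (norm (u x) + 1)" .
    qed (use \<open>0 < C\<close> in auto)
    also have "\<dots> \<le> M"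
      unfolding M_def using t \<open>0 < C\<close> by (intro mult_left_mono) auto
    finally show ?thesis .
  qed
  have "\<forall>\<^sub>F w in at z. M + 1 \<le> norm (f w)"
  proof -
    have "0 < M + 1" by (simp add: M_def add_nonneg_pos)
    with pole show ?thesis
      unfolding is_pole_def filterlim_at_infinity[OF order_refl] by blast
  qed
  then obtain d where "0 < d" and d: "\<And>w. w \<noteq> z \<Longrightarrow> dist w z < d \<Longrightarrow> M + 1 \<le> norm (f w)"
    unfolding eventually_at by blast
  define s where "s = min (r/2) (d/2)"
  have s: "0 < s" "s \<le> r/2" "s < d" using \<open>0 < r\<close> \<open>0 < d\<close> by (auto simp: s_def)
  have "norm (f (z + of_real s)) \<le> M"
    using bound[of "r/2 - s"] s by (simp add: u_def)
  moreover have "M + 1 \<le> norm (f (z + of_real s))"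
    using s by (intro d) (auto simp: dist_norm)
  ultimately show False by simp
qed

text \<open>
  Gronwall's inequality along the ray from the circle of radius \<open>r0\<close> to \<open>z\<close>.
\<close>

lemma linear_ode_upper_bound:
  fixes f h :: "complex \<Rightarrow> complex"
  assumes ode: "\<And>z. R < norm z \<Longrightarrow> (f has_field_derivative h z * f z + 1) (at z)"
    and c: "1 \<le> c'" "c' < c"
    and h: "\<forall>\<^sub>F z in at_infinity. norm (h z) \<le> exp (norm z powr c')"
  shows "\<forall>\<^sub>F z in at_infinity. norm (f z) \<le> exp (exp (norm z powr c))"
proof -
  obtain b where b: "\<And>z. b \<le> norm z \<Longrightarrow> norm (h z) \<le> exp (norm z powr c')"
    using h unfolding eventually_at_infinity by blast
  define r0 where "r0 = max 1 (max b (R + 1))"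
  have r0: "1 \<le> r0" "b \<le> r0" "R < r0" by (auto simp: r0_def)
  have "continuous_on (sphere 0 r0) f"
    using ode r0 by (intro continuous_at_imp_continuous_on ballI DERIV_isCont) auto
  then have "bounded (f ` sphere 0 r0)"
    by (intro compact_imp_bounded compact_continuous_image) auto
  then obtain K where K: "0 < K" "\<And>z. norm z = r0 \<Longrightarrow> norm (f z) \<le> K"
    unfolding bounded_pos by auto
  have main: "norm (f z) \<le> (K + 1) * exp (2 * exp (norm z powr c') * norm z)" if z: "r0 \<le> norm z" for z
  proof -
    define C where "C = exp (norm z powr c')"
    define u where "u t = f (of_real t * sgn z)" for t
    have "z \<noteq> 0" using z r0 by auto
    then have nsgn: "norm (sgn z) = 1" by (simp add: norm_sgn)
    have "norm (u (norm z)) \<le> (norm (u r0) + 1) * exp (2 * C * (norm z - r0))"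
    proof (rule gronwall_norm[OF z])
      show "0 \<le> C" by (simp add: C_def)
      fix x assume x: "r0 \<le> x" "x \<le> norm z"
      let ?w = "of_real x * sgn z"
      have nw: "norm ?w = x" using x r0 nsgn by (simp add: norm_mult)
      have "((\<lambda>t. of_real t * sgn z) has_vector_derivative sgn z) (at x)"
        by (auto intro!: derivative_eq_intros)
      from field_vector_diff_chain_at[OF this ode[of ?w]]
      show "(u has_vector_derivative sgn z * (h ?w * f ?w + 1)) (at x)"
        using nw x r0 by (simp add: u_def[abs_def] o_def)
      have "norm (sgn z * (h ?w * f ?w + 1)) = norm (h ?w * u x + 1)"
        by (simp add: norm_mult nsgn u_def)
      also have "\<dots> \<le> norm (h ?w) * norm (u x) + 1"
        by (metis norm_mult norm_one norm_triangle_ineq)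
      also have "norm (h ?w) \<le> C"
      proof -
        have "norm (h ?w) \<le> exp (x powr c')" using b[of ?w] nw x r0 by simp
        also have "\<dots> \<le> C" using x r0 c by (simp add: C_def powr_mono2)
        finally show ?thesis .
      qed
      then have "norm (h ?w) * norm (u x) + 1 \<le> C * norm (u x) + C"
        by (intro add_mono mult_right_mono) (auto simp: C_def)
      finally show "norm (sgn z * (h ?w * f ?w + 1)) \<le> C * (norm (u x) + 1)"
        by (simp add: algebra_simps)
    qed
    moreover have "u (norm z) = f z"
      using \<open>z \<noteq> 0\<close> by (simp add: u_def sgn_eq)
    moreover have "norm (u r0) \<le> K"
      unfolding u_def using r0 nsgn by (intro K) (simp add: norm_mult)
    ultimately have "norm (f z) \<le> (norm (u r0) + 1) * exp (2 * C * (norm z - r0))" by simp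
    also have "\<dots> \<le> (K + 1) * exp (2 * C * norm z)"
      using \<open>norm (u r0) \<le> K\<close> K(1) r0 by (intro mult_mono) (auto simp: C_def)
    finally show ?thesis by (simp add: C_def)
  qed
  have "\<forall>\<^sub>F x in at_top. (K + 1) * exp (2 * exp (x powr c') * x) \<le> exp (exp (x powr c))"
    using c K(1) by real_asymp
  then have "\<forall>\<^sub>F z::complex in at_infinity.
      (K + 1) * exp (2 * exp (norm z powr c') * norm z) \<le> exp (exp (norm z powr c))"
    by (rule eventually_compose_filterlim[OF _ filterlim_norm_at_top])
  moreover have "\<forall>\<^sub>F z::complex in at_infinity. r0 \<le> norm z"
    by (rule eventually_at_infinityI)
  ultimately show ?thesis
    by eventually_elim (use main in force)
qed

text \<open>
  At a point where \<open>h\<close> is analytic, \<open>f\<close> has no pole, so the differential equation holds there.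
\<close>

lemma nicely_meromorphic_linear_ode:
  fixes f h :: "complex \<Rightarrow> complex"
  assumes f: "f nicely_meromorphic_on UNIV"
    and ode: "\<And>z. \<not> is_pole f z \<Longrightarrow> \<not> is_pole h z \<Longrightarrow> deriv f z = h z * f z + 1"
    and h: "h analytic_on {z}"
  shows "(f has_field_derivative h z * f z + 1) (at z)"
proof -
  have deriv: "(f has_field_derivative h w * f w + 1) (at w)" if "\<not> is_pole f w" "h analytic_on {w}" for w
  proof -
    have "f analytic_on {w}"
      using nicely_meromorphic_on_imp_analytic_at[OF f _ that(1)] by simp
    then have "(f has_field_derivative deriv f w) (at w)"
      using DERIV_deriv_iff_field_differentiable analytic_on_imp_differentiable_at by blast
    then show ?thesis using ode[OF that(1) analytic_at_imp_no_pole[OF that(2)]] by simp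
  qed
  have "isolated_singularity_at f z"
    using f unfolding nicely_meromorphic_on_def
    by (meson UNIV_I meromorphic_on_isolated_singularity meromorphic_on_subset subset_UNIV)
  then have "\<forall>\<^sub>F w in at z. \<not> is_pole f w"
    by (rule eventually_not_pole)
  moreover have "\<forall>\<^sub>F w in at z. h analytic_on {w}"
    using isolated_singularity_at_analytic[OF h] unfolding isolated_singularity_at_altdef .
  ultimately have "\<forall>\<^sub>F w in at z. (f has_field_derivative h w * f w + 1) (at w)"
    by eventually_elim (rule deriv)
  then have "\<not> is_pole f z"
    using analytic_at_imp_isCont[OF h] linear_ode_bounded_coeff_no_pole by blast
  then show ?thesis using deriv h by blast
qed

section \<open>Growth of a rational function times the exponential of a polynomial\<close>

lemma poly_subexponential_bounds:
  fixes p :: "complex poly"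
  assumes "p \<noteq> 0" "0 < \<epsilon>"
  shows "\<forall>\<^sub>F z in at_infinity. exp (- \<epsilon> * norm z) \<le> norm (poly p z) \<and> norm (poly p z) \<le> exp (\<epsilon> * norm z)"
proof -
  define l where "l = norm (lead_coeff p)"
  define d where "d = degree p"
  have "0 < l" using \<open>p \<noteq> 0\<close> by (simp add: l_def)
  have lim: "((\<lambda>z. norm (poly p z / z ^ d)) \<longlongrightarrow> l) at_infinity"
    unfolding l_def d_def by (intro tendsto_norm poly_divide_tendsto_aux)
  have "\<forall>\<^sub>F z in at_infinity. l / 2 < norm (poly p z / z ^ d)"
    using lim \<open>0 < l\<close> by (intro order_tendstoD(1)[OF lim]) simp
  moreover have "\<forall>\<^sub>F z in at_infinity. norm (poly p z / z ^ d) < 2 * l"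
    using lim \<open>0 < l\<close> by (intro order_tendstoD(2)[OF lim]) simp
  moreover have "\<forall>\<^sub>F x in at_top. exp (- \<epsilon> * x) \<le> l / 2 * x ^ d"
    using \<open>0 < l\<close> \<open>0 < \<epsilon>\<close> by real_asymp
  then have "\<forall>\<^sub>F z::complex in at_infinity. exp (- \<epsilon> * norm z) \<le> l / 2 * norm z ^ d"
    by (rule eventually_compose_filterlim[OF _ filterlim_norm_at_top])
  moreover have "\<forall>\<^sub>F x in at_top. 2 * l * x ^ d \<le> exp (\<epsilon> * x)"
    using \<open>0 < l\<close> \<open>0 < \<epsilon>\<close> by real_asymp
  then have "\<forall>\<^sub>F z::complex in at_infinity. 2 * l * norm z ^ d \<le> exp (\<epsilon> * norm z)"
    by (rule eventually_compose_filterlim[OF _ filterlim_norm_at_top])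
  ultimately show ?thesis
    using eventually_norm_gt_at_infinity[of 0]
  proof eventually_elim
    case (elim z)
    have "l / 2 * norm z ^ d \<le> norm (poly p z)" "norm (poly p z) \<le> 2 * l * norm z ^ d"
      using elim(1,2,5) by (simp_all add: norm_divide norm_power field_simps)
    with elim(3,4) show ?case by linarith
  qed
qed

lemma exp_poly_growth_upper:
  fixes P p q :: "complex poly"
  assumes "p \<noteq> 0" "q \<noteq> 0" and c: "real (degree P) < c" "1 < c"
  shows "\<forall>\<^sub>F z in at_infinity. norm (poly p z / poly q z * exp (poly P z)) \<le> exp (norm z powr c)"
proof -
  define n where "n = degree P"
  define l where "l = norm (lead_coeff P) + 1"
  have lim: "((\<lambda>z. norm (poly P z / z ^ n)) \<longlongrightarrow> norm (lead_coeff P)) at_infinity"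
    unfolding n_def by (intro tendsto_norm poly_divide_tendsto_aux)
  have "\<forall>\<^sub>F z in at_infinity. norm (poly P z / z ^ n) < l"
    by (intro order_tendstoD(2)[OF lim]) (simp add: l_def)
  moreover have "\<forall>\<^sub>F x in at_top. 2 * x + l * x powr n \<le> x powr c"
  proof -
    define m where "m = real n"
    have "0 < l" "m < c" using c by (auto simp: l_def m_def n_def add_nonneg_pos)
    then have "\<forall>\<^sub>F x in at_top. l * x powr m \<le> 1/2 * x powr c" by real_asymp
    moreover have "\<forall>\<^sub>F x in at_top. 2 * x \<le> 1/2 * x powr c" using \<open>1 < c\<close> by real_asymp
    ultimately show ?thesis unfolding m_def by eventually_elim linarith
  qed
  then have "\<forall>\<^sub>F z::complex in at_infinity. 2 * norm z + l * norm z powr n \<le> norm z powr c"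
    by (rule eventually_compose_filterlim[OF _ filterlim_norm_at_top])
  ultimately show ?thesis
    using eventually_norm_gt_at_infinity[of 0]
      poly_subexponential_bounds[OF \<open>p \<noteq> 0\<close> zero_less_one] poly_subexponential_bounds[OF \<open>q \<noteq> 0\<close> zero_less_one]
  proof eventually_elim
    case (elim z)
    have "norm (poly P z) \<le> l * norm z powr n"
      using elim(1,3) by (simp add: norm_divide norm_power field_simps powr_realpow)
    then have P: "Re (poly P z) \<le> l * norm z powr n"
      using complex_Re_le_cmod order_trans by blast
    have "norm (poly p z) / norm (poly q z) \<le> exp (norm z) / exp (- norm z)"
      using elim(4,5) by (intro frac_le) auto
    also have "\<dots> = exp (2 * norm z)" by (simp add: exp_diff[symmetric])
    finally have "norm (poly p z / poly q z * exp (poly P z)) \<le> exp (2 * norm z) * exp (l * norm z powr n)"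
      unfolding norm_mult norm_divide norm_exp_eq_Re using P by (intro mult_mono) auto
    also have "\<dots> \<le> exp (norm z powr c)"
      using elim(2) by (simp add: exp_add[symmetric])
    finally show ?case .
  qed
qed

text \<open>
  The witnesses are the large positive reals, where \<open>Re (P x)\<close> is at least half of \<open>x ^ n\<close>.
\<close>

lemma exp_poly_growth_lower:
  fixes P p q :: "complex poly"
  assumes "p \<noteq> 0" "q \<noteq> 0" "0 < degree P" "lead_coeff P = 1" and c: "c < real (degree P)"
  shows "\<exists>\<^sub>F z in at_infinity. exp (norm z powr c) < norm (poly p z / poly q z * exp (poly P z))"
proof -
  define n where "n = degree P"
  \<comment> \<open>The rational factor costs at most a factor \<open>exp (- x / 4)\<close>, which is affordable even for \<open>n = 1\<close>.\<close>
  have eighth: "0 < (1/8 :: real)" by simp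
  have "((\<lambda>z. poly P z / z ^ n) \<longlongrightarrow> 1) at_infinity"
    using poly_divide_tendsto_aux[of P] assms by (simp add: n_def)
  from tendstoD[OF this, of "1/2"]
  have "\<forall>\<^sub>F z in at_infinity. dist (poly P z / z ^ n) 1 < 1/2" by simp
  moreover have "\<forall>\<^sub>F x in at_top. x powr c < 1/2 * x powr n - 1/4 * x"
  proof -
    define m where "m = real n"
    have "1 \<le> m" "c < m" using assms by (auto simp: m_def n_def)
    then have "\<forall>\<^sub>F x in at_top. x powr c < 1/4 * x powr m" by real_asymp
    then show ?thesis
      unfolding m_def[symmetric] using eventually_ge_at_top[of 1]
    proof eventually_elim
      case (elim x)
      then show ?case using powr_mono[OF \<open>1 \<le> m\<close>, of x] by simp
    qed
  qed
  then have "\<forall>\<^sub>F z::complex in at_infinity. norm z powr c < 1/2 * norm z powr n - 1/4 * norm z"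
    by (rule eventually_compose_filterlim[OF _ filterlim_norm_at_top])
  ultimately have "\<forall>\<^sub>F z in at_infinity. z \<in> \<real> \<longrightarrow> 0 < Re z \<longrightarrow>
      exp (norm z powr c) < norm (poly p z / poly q z * exp (poly P z))"
    using eventually_norm_gt_at_infinity[of 0]
      poly_subexponential_bounds[OF \<open>p \<noteq> 0\<close> eighth] poly_subexponential_bounds[OF \<open>q \<noteq> 0\<close> eighth]
  proof eventually_elim
    case (elim z)
    show ?case
    proof (intro impI)
      assume z: "z \<in> \<real>" "0 < Re z"
      define x where "x = Re z"
      have zx: "z = of_real x" "norm z = x" using z by (auto simp: x_def complex_is_Real_iff complex_eq_iff cmod_def)
      define r where "r = Re (poly P z / z ^ n)"
      have "\<bar>r - 1\<bar> \<le> dist (poly P z / z ^ n) 1"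
        unfolding dist_norm r_def using abs_Re_le_cmod[of "poly P z / z ^ n - 1"] by simp
      with elim(1) have "1/2 \<le> r" by linarith
      moreover have "Re (poly P z) = r * x ^ n"
      proof -
        have "poly P z = (poly P z / z ^ n) * of_real (x ^ n)"
          using elim(3) by (simp add: zx)
        then show ?thesis unfolding r_def by (metis Re_complex_of_real times_complex.sel(1) Im_complex_of_real mult_zero_right diff_zero)
      qed
      ultimately have P: "1/2 * x powr n \<le> Re (poly P z)"
        using z by (simp add: x_def powr_realpow)
      have "exp (norm z powr c) < exp (1/2 * norm z powr n - 1/4 * norm z)"
        using elim(2) by simp
      also have "\<dots> = exp (- (1/8) * norm z) / exp (1/8 * norm z) * exp (1/2 * x powr n)"
        unfolding zx(2) by (simp add: exp_diff[symmetric] exp_add[symmetric])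
      also have "\<dots> \<le> norm (poly p z) / norm (poly q z) * exp (Re (poly P z))"
        using elim(4,5) P by (intro mult_mono frac_le) (auto intro: less_le_trans[OF exp_gt_zero])
      finally show "exp (norm z powr c) < norm (poly p z / poly q z * exp (poly P z))"
        by (simp add: norm_mult norm_divide)
    qed
  qed
  then obtain b where b: "\<And>z. b \<le> norm z \<Longrightarrow> z \<in> \<real> \<Longrightarrow> 0 < Re z \<Longrightarrow>
      exp (norm z powr c) < norm (poly p z / poly q z * exp (poly P z))"
    unfolding eventually_at_infinity by blast
  show ?thesis
    unfolding frequently_def
  proof
    assume "\<forall>\<^sub>F z in at_infinity. \<not> exp (norm z powr c) < norm (poly p z / poly q z * exp (poly P z))"
    then obtain a where a: "\<And>z. a \<le> norm z \<Longrightarrow> \<not> exp (norm z powr c) < norm (poly p z / poly q z * exp (poly P z))"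
      unfolding eventually_at_infinity by blast
    define z where "z = complex_of_real (max 1 (max a b))"
    have "a \<le> norm z" "b \<le> norm z" "z \<in> \<real>" "0 < Re z" by (auto simp: z_def)
    with a b show False by blast
  qed
qed

section \<open>The perturbed model equation in a half-strip\<close>

lemma norm_exp_minus_one_le:
  fixes z :: complex assumes "norm z \<le> 1/2" shows "norm (exp z - 1) \<le> 2 * norm z"
  using norm_exp_bounds(2)[of z] assms norm_ge_zero[of z] by linarith

text \<open>
  The equation \<open>y' = e\<^sup>\<tau> y + 1\<close> has the integrating factor \<open>exp (- exp \<tau>)\<close>. In the variable
  \<open>w = exp \<tau>\<close> its primitive is a primitive of \<open>exp (- w) / w\<close>, which is not single-valued: its
  increment along \<open>[0, 2\<pi>\<i>]\<close> is \<open>2\<pi>\<i>\<close> times the residue 1 at \<open>w = 0\<close>.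
\<close>

lemma exp_minus_exp_primitive:
  obtains E :: "complex \<Rightarrow> complex"
  where "\<And>\<tau>. (E has_field_derivative exp (- exp \<tau>)) (at \<tau>)" "E (2 * pi * \<i>) - E 0 = 2 * pi * \<i>"
proof -
  \<comment> \<open>Subtracting the pole leaves the entire function \<open>k\<close>, with primitive \<open>G\<close>; the pole contributes the term \<open>\<tau>\<close> of \<open>E\<close>.\<close>
  define k :: "complex \<Rightarrow> complex" where "k w = (if w = 0 then -1 else (exp (- w) - 1) / w)" for w
  have "((\<lambda>w. exp (- w)) has_field_derivative -1) (at (0::complex))"
    by (auto intro!: derivative_eq_intros)
  then have "(\<lambda>w. (exp (- w) - 1) / w) \<midarrow>0\<rightarrow> (-1::complex)"
    by (simp add: has_field_derivative_iff)
  then have k0: "k \<midarrow>0\<rightarrow> k 0"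
    using LIM_equal[of 0 k "\<lambda>w. (exp (- w) - 1) / w" "-1"] by (simp add: k_def)
  have k1: "k field_differentiable at w" if "w \<noteq> 0" for w
  proof -
    have "(\<lambda>w. (exp (- w) - 1) / w) holomorphic_on (-{0})"
      by (intro holomorphic_intros) auto
    then have "k holomorphic_on (-{0})"
      by (rule holomorphic_transform) (auto simp: k_def)
    then show ?thesis
      using that by (auto intro: holomorphic_on_imp_differentiable_at)
  qed
  have "continuous_on UNIV k"
    using k0 k1 by (metis continuous_at_imp_continuous_on field_differentiable_imp_continuous_at isCont_def)
  then obtain G where G: "\<And>w. (G has_field_derivative k w) (at w)"
    using holomorphic_convex_primitive[of UNIV "{0}" k] k1 by auto
  define E where "E \<tau> = \<tau> + G (exp \<tau>)" for \<tau>
  show ?thesis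
  proof
    fix \<tau>
    have "(E has_field_derivative 1 + k (exp \<tau>) * exp \<tau>) (at \<tau>)"
      unfolding E_def by (auto intro!: derivative_eq_intros DERIV_chain2[OF G])
    then show "(E has_field_derivative exp (- exp \<tau>)) (at \<tau>)"
      by (simp add: k_def)
  next
    show "E (2 * pi * \<i>) - E 0 = 2 * pi * \<i>"
      by (simp add: E_def exp_eq_polar)
  qed
qed

text \<open>
  Here \<open>exp (- H)\<close> is an integrating factor of \<open>y' = A e\<^sup>\<tau> y + B\<close>. On the horizontal ray from
  \<open>p\<close> (where \<open>e\<^sup>\<tau> > 0\<close>) a nonzero multiple of the homogeneous solution would grow like
  \<open>exp (exp t)\<close>. If \<open>y\<close> grows more slowly, then \<open>exp (- H) y\<close> tends to 0, so its value at \<open>p\<close> is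
  minus the integral of its derivative \<open>exp (- H) B\<close> along the ray, of norm at most about \<open>exp (- Re (H p))\<close>.
\<close>

lemma ray_bound:
  fixes y A B H :: "complex \<Rightarrow> complex"
  assumes p: "exp p = 1"
    and dH: "\<And>t. 0 \<le> t \<Longrightarrow> (H has_field_derivative A (p + of_real t) * exp (p + of_real t)) (at (p + of_real t))"
    and dy: "\<And>t. 0 \<le> t \<Longrightarrow> (y has_field_derivative A (p + of_real t) * exp (p + of_real t) * y (p + of_real t) + B (p + of_real t)) (at (p + of_real t))"
    and A: "\<And>t. 0 \<le> t \<Longrightarrow> norm (A (p + of_real t) - 1) \<le> 1/100"
    and B: "\<And>t. 0 \<le> t \<Longrightarrow> norm (B (p + of_real t) - 1) \<le> 1/100"
    and growth: "\<forall>\<^sub>F t in at_top. norm (y (p + of_real t)) \<le> exp (exp (t/2))"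
  shows "norm (exp (- H p) * y p) \<le> 104/100 * exp (- Re (H p))"
proof -
  define u where "u t = exp (- H (p + of_real t)) * y (p + of_real t)" for t
  have expp: "exp (p + of_real t) = of_real (exp t)" for t
    by (simp add: exp_add p exp_of_real)
  have dp: "((\<lambda>t. p + of_real t) has_vector_derivative 1) (at t)" for t
    by (auto intro!: derivative_eq_intros)
  have du: "(u has_vector_derivative exp (- H (p + of_real t)) * B (p + of_real t)) (at t)" if "0 \<le> t" for t
  proof -
    have "((\<lambda>\<tau>. exp (- H \<tau>) * y \<tau>) has_field_derivative exp (- H (p + of_real t)) * B (p + of_real t)) (at (p + of_real t))"
      by (auto intro!: derivative_eq_intros dH dy that simp: algebra_simps)
    from field_vector_diff_chain_at[OF dp this] show ?thesis
      by (simp add: u_def[abs_def] o_def)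
  qed
  have ReH: "Re (H (p + of_real t)) \<ge> Re (H p) + 99/100 * (exp t - 1)" if "0 \<le> t" for t
  proof -
    have "\<exists>d. ((\<lambda>t. Re (H (p + of_real t)) - 99/100 * exp t) has_real_derivative d) (at x) \<and> 0 \<le> d"
      if x: "0 \<le> x" "x \<le> t" for x
    proof -
      have "((\<lambda>t. H (p + of_real t)) has_vector_derivative A (p + of_real x) * exp (p + of_real x)) (at x)"
        using field_vector_diff_chain_at[OF dp dH[OF x(1)]] by (simp add: o_def)
      then have "((\<lambda>t. Re (H (p + of_real t))) has_real_derivative Re (A (p + of_real x) * exp (p + of_real x))) (at x)"
        unfolding has_real_derivative_iff_has_vector_derivative
        by (rule bounded_linear.has_vector_derivative[OF bounded_linear_Re])
      then have D: "((\<lambda>t. Re (H (p + of_real t)) - 99/100 * exp t) has_real_derivative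
          Re (A (p + of_real x) * exp (p + of_real x)) - 99/100 * exp x) (at x)"
        by (intro DERIV_diff DERIV_cmult DERIV_exp)
      have "\<bar>Re (A (p + of_real x) - 1)\<bar> \<le> 1/100"
        using A[OF x(1)] abs_Re_le_cmod order_trans by blast
      then have "\<bar>Re (A (p + of_real x)) - 1\<bar> \<le> 1/100" by simp
      then have "99/100 \<le> Re (A (p + of_real x))" by linarith
      then have "0 \<le> Re (A (p + of_real x) * exp (p + of_real x)) - 99/100 * exp x"
        by (simp add: expp)
      with D show ?thesis by blast
    qed
    from DERIV_nonneg_imp_nondecreasing[OF \<open>0 \<le> t\<close> this]
    show ?thesis by (simp add: field_simps)
  qed
  \<comment> \<open>The derivative of \<open>u\<close> decays like \<open>exp (- 99/100 x)\<close> because \<open>e\<^sup>x - 1 \<ge> x\<close>.\<close>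
  have diff: "norm (u t - u 0) \<le> 102/99 * exp (- Re (H p))" if t: "0 < t" for t
  proof -
    define \<phi> where "\<phi> x = - (102/99) * exp (- Re (H p)) * exp (- (99/100 * x))" for x :: real
    have "norm (u t - u 0) \<le> \<phi> t - \<phi> 0"
    proof (rule differentiable_bound_general[OF t])
      show "continuous_on {0..t} u"
        using du by (intro continuous_at_imp_continuous_on ballI has_vector_derivative_continuous) auto
      show "continuous_on {0..t} \<phi>" unfolding \<phi>_def by (intro continuous_intros)
      fix x assume x: "0 < x" "x < t"
      show "(u has_vector_derivative exp (- H (p + of_real x)) * B (p + of_real x)) (at x)"
        using x by (intro du) auto
      show "(\<phi> has_vector_derivative 102/100 * exp (- Re (H p)) * exp (- (99/100 * x))) (at x)"
        unfolding \<phi>_def has_real_derivative_iff_has_vector_derivative[symmetric]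
        by (auto intro!: derivative_eq_intros)
      have "norm (B (p + of_real x)) \<le> 102/100"
        using B[of x] x norm_triangle_sub[of "B (p + of_real x)" 1] by auto
      moreover have "Re (H (p + of_real x)) \<ge> Re (H p) + 99/100 * x"
      proof -
        have "99/100 * x \<le> 99/100 * (exp x - 1)"
          by (intro mult_left_mono) (simp_all add: le_diff_eq add.commute)
        with ReH[OF less_imp_le[OF x(1)]] show ?thesis by linarith
      qed
      ultimately have "norm (exp (- H (p + of_real x)) * B (p + of_real x))
          \<le> exp (- (Re (H p) + 99/100 * x)) * (102/100)"
        unfolding norm_mult norm_exp_eq_Re by (intro mult_mono) auto
      also have "\<dots> = 102/100 * exp (- Re (H p)) * exp (- (99/100 * x))"
        by (simp add: exp_add[symmetric])
      finally show "norm (exp (- H (p + of_real x)) * B (p + of_real x)) \<le> \<dots>" .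
    qed
    also have "\<dots> \<le> 102/99 * exp (- Re (H p))"
      by (simp add: \<phi>_def)
    finally show ?thesis .
  qed
  have "(u \<longlongrightarrow> 0) at_top"
  proof (rule Lim_null_comparison)
    show "\<forall>\<^sub>F t in at_top. norm (u t) \<le> exp (- Re (H p)) * exp (exp (t/2) - 99/100 * (exp t - 1))"
      using growth eventually_ge_at_top[of 0]
    proof eventually_elim
      case (elim t)
      have "norm (u t) \<le> exp (- (Re (H p) + 99/100 * (exp t - 1))) * exp (exp (t/2))"
        unfolding u_def norm_mult norm_exp_eq_Re
        using elim ReH[of t] by (intro mult_mono) auto
      also have "\<dots> = exp (- Re (H p)) * exp (exp (t/2) - 99/100 * (exp t - 1))"
        by (simp add: exp_add[symmetric])
      finally show ?case .
    qed
    have "((\<lambda>t::real. exp (exp (t/2) - 99/100 * (exp t - 1))) \<longlongrightarrow> 0) at_top"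
      by real_asymp
    from tendsto_mult_right_zero[OF this]
    show "((\<lambda>t. exp (- Re (H p)) * exp (exp (t/2) - 99/100 * (exp t - 1))) \<longlongrightarrow> 0) at_top" .
  qed
  then have "((\<lambda>t. norm (u t - u 0)) \<longlongrightarrow> norm (0 - u 0)) at_top"
    by (intro tendsto_intros)
  moreover have "\<forall>\<^sub>F t in at_top. norm (u t - u 0) \<le> 102/99 * exp (- Re (H p))"
    using eventually_gt_at_top[of 0] by eventually_elim (rule diff)
  ultimately have "norm (0 - u 0) \<le> 102/99 * exp (- Re (H p))"
    by (rule tendsto_upperbound) simp
  also have "\<dots> \<le> 104/100 * exp (- Re (H p))" by simp
  finally show ?thesis by (simp add: u_def norm_minus_commute)
qed

lemma open_convex_half_strip:
  shows "open {\<tau>. -1 < Re \<tau> \<and> -1 < Im \<tau> \<and> Im \<tau> < 7}"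
    and "convex {\<tau>. -1 < Re \<tau> \<and> -1 < Im \<tau> \<and> Im \<tau> < 7}"
proof -
  have eq: "{\<tau>. -1 < Re \<tau> \<and> -1 < Im \<tau> \<and> Im \<tau> < 7} = {\<tau>. Re \<tau> > -1} \<inter> {\<tau>. Im \<tau> > -1} \<inter> {\<tau>. Im \<tau> < 7}"
    by auto
  show "open {\<tau>. -1 < Re \<tau> \<and> -1 < Im \<tau> \<and> Im \<tau> < 7}"
    unfolding eq
    by (intro open_Int open_halfspace_Re_gt open_halfspace_Im_gt open_halfspace_Im_lt)
  show "convex {\<tau>. -1 < Re \<tau> \<and> -1 < Im \<tau> \<and> Im \<tau> < 7}"
    unfolding eq
    by (intro convex_Int convex_halfspace_Re_gt convex_halfspace_Im_gt convex_halfspace_Im_lt)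
qed

text \<open>
  A solution of the perturbed model equation cannot grow slowly on both of the lines
  \<open>Im \<tau> = 0\<close> and \<open>Im \<tau> = 2\<pi>\<close>: otherwise \<open>u = exp (- H) y\<close> has norm at most 104/100 at \<open>0\<close> and at \<open>2\<pi>\<i>\<close> by
  \<open>ray_bound\<close>, whereas \<open>u(2\<pi>\<i>) - u(0)\<close> is close to the increment \<open>2\<pi>\<i>\<close> of
  \<open>exp_minus_exp_primitive\<close>.
\<close>

lemma strip_growth:
  fixes y A B :: "complex \<Rightarrow> complex"
  defines "T \<equiv> {\<tau>. -1 < Re \<tau> \<and> -1 < Im \<tau> \<and> Im \<tau> < 7}"
  assumes hol: "A holomorphic_on T"
    and dy: "\<And>\<tau>. \<tau> \<in> T \<Longrightarrow> (y has_field_derivative A \<tau> * exp \<tau> * y \<tau> + B \<tau>) (at \<tau>)"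
    and A: "\<And>\<tau>. \<tau> \<in> T \<Longrightarrow> norm (A \<tau> - 1) \<le> 1/100"
    and B: "\<And>\<tau>. \<tau> \<in> T \<Longrightarrow> norm (B \<tau> - 1) \<le> 1/100"
    and growth0: "\<forall>\<^sub>F t in at_top. norm (y (of_real t)) \<le> exp (exp (t/2))"
    and growth1: "\<forall>\<^sub>F t in at_top. norm (y (2 * pi * \<i> + of_real t)) \<le> exp (exp (t/2))"
  shows False
proof -
  have pi: "3 < pi" "pi < 32/10"
    using pi_approx by auto
  have T: "open T" "convex T"
    unfolding T_def by (rule open_convex_half_strip)+
  have "(\<lambda>\<tau>. A \<tau> * exp \<tau>) holomorphic_on T"
    by (intro holomorphic_intros hol)
  then obtain H0 where H0: "\<And>\<tau>. \<tau> \<in> T \<Longrightarrow> (H0 has_field_derivative A \<tau> * exp \<tau>) (at \<tau> within T)"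
    using holomorphic_convex_primitive'[OF T(2,1)] by blast
  \<comment> \<open>Normalised so that \<open>H\<close> is close to \<open>exp\<close> on the segment from 0 to \<open>2\<pi>\<i>\<close>.\<close>
  define H where "H \<tau> = H0 \<tau> - H0 0 + 1" for \<tau>
  have dH: "(H has_field_derivative A \<tau> * exp \<tau>) (at \<tau>)" if "\<tau> \<in> T" for \<tau>
  proof -
    have "(H0 has_field_derivative A \<tau> * exp \<tau>) (at \<tau>)"
      using H0[OF that] at_within_open[OF that T(1)] by simp
    then show ?thesis
      unfolding H_def by (auto intro!: derivative_eq_intros)
  qed
  define p where "p = complex_of_real (2 * pi) * \<i>"
  have expp: "exp p = 1" by (simp add: p_def exp_eq_polar)
  have inT: "of_real t \<in> T" "p + of_real t \<in> T" if "0 \<le> t" for t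
    using that pi by (auto simp: T_def p_def)
  define S where "S = closed_segment 0 p"
  have S: "Re \<tau> = 0" "0 \<le> Im \<tau>" "Im \<tau> \<le> 2 * pi" if "\<tau> \<in> S" for \<tau>
    using that pi by (auto simp: S_def p_def in_segment mult_left_le_one_le)
  have ST: "\<tau> \<in> T" if "\<tau> \<in> S" for \<tau>
    using S[OF that] pi by (auto simp: T_def)
  have H1: "norm (H \<tau> - exp \<tau>) \<le> 7/100" if \<tau>: "\<tau> \<in> S" for \<tau>
  proof -
    have "norm ((H \<tau> - exp \<tau>) - (H 0 - exp 0)) \<le> 1/100 * norm (\<tau> - 0)"
    proof (rule field_differentiable_bound[of S])
      show "((\<lambda>\<tau>. H \<tau> - exp \<tau>) has_field_derivative (A z - 1) * exp z) (at z within S)" if "z \<in> S" for z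
        by (rule has_field_derivative_at_within)
           (auto intro!: derivative_eq_intros dH ST that simp: algebra_simps)
      show "norm ((A z - 1) * exp z) \<le> 1/100" if "z \<in> S" for z
        using A[OF ST[OF that]] S(1)[OF that] by (simp add: norm_mult)
    qed (use \<tau> in \<open>auto simp: S_def\<close>)
    also have "norm (\<tau> - 0) \<le> 7"
      using S[OF \<tau>] pi by (simp add: cmod_def)
    finally show ?thesis by (simp add: H_def)
  qed
  obtain E :: "complex \<Rightarrow> complex" 
    where E: "\<And>\<tau>. (E has_field_derivative exp (- exp \<tau>)) (at \<tau>)" "E p - E 0 = 2 * pi * \<i>"
    using exp_minus_exp_primitive unfolding p_def by (metis of_real_mult of_real_numeral)
  define u where "u \<tau> = exp (- H \<tau>) * y \<tau>" for \<tau>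
  have cross: "norm ((u p - E p) - (u 0 - E 0)) \<le> 48/100 * norm (p - 0)"
  proof (rule field_differentiable_bound[of S])
    show "((\<lambda>\<tau>. u \<tau> - E \<tau>) has_field_derivative exp (- H z) * B z - exp (- exp z)) (at z within S)" if "z \<in> S" for z
      unfolding u_def
      by (rule has_field_derivative_at_within)
         (auto intro!: derivative_eq_intros dH dy E(1) ST that simp: algebra_simps)
    show "norm (exp (- H z) * B z - exp (- exp z)) \<le> 48/100" if z: "z \<in> S" for z
    proof -
      define w where "w = exp z - H z"
      have w: "norm w \<le> 7/100"
        using H1[OF z] by (simp add: w_def norm_minus_commute)
      have "norm (exp w * B z - 1) = norm ((exp w - 1) * (B z - 1) + (exp w - 1) + (B z - 1))"
        by (simp add: algebra_simps)
      also have "\<dots> \<le> norm (exp w - 1) * norm (B z - 1) + norm (exp w - 1) + norm (B z - 1)"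
        by (intro norm_triangle_le add_mono) (auto simp: norm_mult)
      also have "\<dots> \<le> (14/100) * (1/100) + 14/100 + 1/100"
        using norm_exp_minus_one_le[of w] w B[OF ST[OF z]] by (intro add_mono mult_mono) auto
      finally have 1: "norm (exp w * B z - 1) \<le> 16/100" by simp
      have "exp (- H z) * B z - exp (- exp z) = exp (- exp z) * (exp w * B z - 1)"
        by (simp add: w_def algebra_simps flip: exp_add)
      then have "norm (exp (- H z) * B z - exp (- exp z)) = exp (- Re (exp z)) * norm (exp w * B z - 1)"
        by (simp add: norm_mult)
      also have "\<dots> \<le> 3 * (16/100)"
      proof (intro mult_mono 1)
        have "\<bar>Re (exp z)\<bar> \<le> 1"
          using abs_Re_le_cmod[of "exp z"] S(1)[OF z] by simp
        then have "exp (- Re (exp z)) \<le> exp 1"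
          by (subst exp_le_cancel_iff) linarith
        then show "exp (- Re (exp z)) \<le> 3" using exp_le by linarith
      qed auto
      finally show ?thesis by simp
    qed
  qed (auto simp: S_def)
  also have "48/100 * norm (p - 0) \<le> 48/100 * (64/10)"
    using pi by (simp add: p_def norm_mult)
  finally have "norm ((u p - u 0) - 2 * pi * \<i>) \<le> 48/100 * (64/10)"
    unfolding E(2)[symmetric] by (simp add: algebra_simps)
  moreover have "norm (2 * pi * \<i>) \<le> norm (u p - u 0) + norm ((u p - u 0) - 2 * pi * \<i>)"
    by (metis norm_minus_commute norm_triangle_sub)
  moreover have "norm (2 * pi * \<i>) = 2 * pi" by (simp add: norm_mult)
  ultimately have big: "norm (u p - u 0) \<ge> 6 - 48/100 * (64/10)"
    using pi by linarith
  have "norm (u 0) \<le> 104/100 * exp (- Re (H 0))"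
    unfolding u_def using growth0 inT A[OF inT(1)] B[OF inT(1)]
    by (intro ray_bound[where A = A and B = B and H = H and y = y and p = 0]) (auto intro!: dH dy)
  moreover have "norm (u p) \<le> 104/100 * exp (- Re (H p))"
    unfolding u_def using growth1 inT expp A[OF inT(2)] B[OF inT(2)]
    by (intro ray_bound[where A = A and B = B and H = H and y = y and p = p]) (auto intro!: dH dy simp: p_def)
  moreover have "exp (- Re (H 0)) \<le> 1" by (simp add: H_def)
  moreover have "exp (- Re (H p)) \<le> 1"
  proof -
    have "norm (H p - 1) \<le> 7/100" using H1[of p] expp by (simp add: S_def)
    then have "\<bar>Re (H p - 1)\<bar> \<le> 7/100" using abs_Re_le_cmod order_trans by blast
    then have "\<bar>Re (H p) - 1\<bar> \<le> 7/100" by simp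
    then have "0 \<le> Re (H p)" by linarith
    then show ?thesis by simp
  qed
  moreover have "norm (u p - u 0) \<le> norm (u p) + norm (u 0)" by (rule norm_triangle_ineq4)
  ultimately show False using big by simp
qed

section \<open>Inverting a perturbation of the identity\<close>

lemma open_convex_oblique_halfplane:
  fixes M :: real
  shows "open {\<omega>. M < Re \<omega> + Im \<omega>}" "convex {\<omega>. M < Re \<omega> + Im \<omega>}"
proof -
  have "{\<omega>. M < Re \<omega> + Im \<omega>} = {\<omega>. M < Complex 1 1 \<bullet> \<omega>}"
    by (simp add: inner_complex_def)
  then show "open {\<omega>. M < Re \<omega> + Im \<omega>}" "convex {\<omega>. M < Re \<omega> + Im \<omega>}"
    by (simp_all add: open_halfspace_gt convex_halfspace_gt)
qed

text \<open>
  If \<open>L'\<close> is uniformly close to 1 on the half-plane \<open>Re \<omega> + Im \<omega> > M\<close>, then \<open>L\<close> has a holomorphic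
  inverse on a region \<open>Re \<tau> > -1\<close>, \<open>Im \<tau> > K\<close>. The oblique half-plane is convex and contains both
  the far positive imaginary axis and, for each fixed height, the far end of the horizontal
  line; on it \<open>L\<close> differs from the identity by at most a small multiple of \<open>|\<omega>|\<close> plus a constant. A preimage of
  \<open>\<tau>\<close> is a fixed point of the contraction \<open>\<omega> \<mapsto> \<tau> - (L \<omega> - \<omega>)\<close>.
\<close>

lemma near_identity_inverse:
  fixes L :: "complex \<Rightarrow> complex" and M :: real
  defines "\<Omega> \<equiv> {\<omega>. M < Re \<omega> + Im \<omega>}"
  assumes hol: "L holomorphic_on \<Omega>"
    and dL: "\<And>\<omega>. \<omega> \<in> \<Omega> \<Longrightarrow> norm (deriv L \<omega> - 1) \<le> 1/400"
  shows "\<exists>Q K. \<forall>\<tau>. -1 < Re \<tau> \<longrightarrow> K < Im \<tau> \<longrightarrow>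
    Q \<tau> \<in> \<Omega> \<and> L (Q \<tau>) = \<tau> \<and> norm (Q \<tau> - \<tau>) \<le> norm \<tau> / 4 \<and>
    (Q has_field_derivative deriv Q \<tau>) (at \<tau>) \<and> norm (deriv Q \<tau> - 1) \<le> 1/200"
proof -
  have \<Omega>: "open \<Omega>" "convex \<Omega>"
    unfolding \<Omega>_def by (rule open_convex_oblique_halfplane)+
  have LD: "(L has_field_derivative deriv L \<omega>) (at \<omega>)" if "\<omega> \<in> \<Omega>" for \<omega>
    using hol \<Omega>(1) that by (rule holomorphic_derivI)
  have lip: "norm ((L a - a) - (L b - b)) \<le> 1/400 * norm (a - b)" if "a \<in> \<Omega>" "b \<in> \<Omega>" for a b
  proof (rule field_differentiable_bound[OF \<Omega>(2) _ _ that])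
    show "((\<lambda>\<omega>. L \<omega> - \<omega>) has_field_derivative deriv L z - 1) (at z within \<Omega>)" if "z \<in> \<Omega>" for z
      by (rule has_field_derivative_at_within) (auto intro!: derivative_eq_intros LD that)
  qed (rule dL)
  have inj: "inj_on L \<Omega>"
  proof (rule inj_onI)
    fix a b assume "a \<in> \<Omega>" "b \<in> \<Omega>" "L a = L b"
    then show "a = b" using lip[of a b] by (simp add: norm_minus_commute)
  qed
  define \<omega>0 where "\<omega>0 = complex_of_real (\<bar>M\<bar> + 1)"
  have \<omega>0: "\<omega>0 \<in> \<Omega>" by (simp add: \<Omega>_def \<omega>0_def)
  define C where "C = norm (L \<omega>0 - \<omega>0) + norm \<omega>0"
  define K where "K = 2 * \<bar>M\<bar> + 4 + 8 * C"
  have "0 \<le> C" by (simp add: C_def)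
  have surj: "\<exists>\<omega>\<in>\<Omega>. L \<omega> = \<tau> \<and> norm (\<omega> - \<tau>) \<le> norm \<tau> / 4" if \<tau>: "-1 < Re \<tau>" "K < Im \<tau>" for \<tau>
  proof -
    have n\<tau>: "norm \<tau> \<ge> K" using \<tau>(2) abs_Im_le_cmod[of \<tau>] by linarith
    have "norm \<tau> \<le> \<bar>Re \<tau>\<bar> + \<bar>Im \<tau>\<bar>" by (rule cmod_le)
    then have s\<tau>: "norm \<tau> - 2 \<le> Re \<tau> + Im \<tau>" using \<tau> \<open>0 \<le> C\<close> by (simp add: K_def)
    define S where "S = cball \<tau> (norm \<tau> / 4)"
    have S\<Omega>: "\<omega> \<in> \<Omega>" if "\<omega> \<in> S" for \<omega>
    proof -
      have "norm (\<omega> - \<tau>) \<le> norm \<tau> / 4" using that by (simp add: S_def dist_norm norm_minus_commute)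
      moreover have "\<bar>Re (\<omega> - \<tau>)\<bar> \<le> norm (\<omega> - \<tau>)" "\<bar>Im (\<omega> - \<tau>)\<bar> \<le> norm (\<omega> - \<tau>)"
        by (rule abs_Re_le_cmod abs_Im_le_cmod)+
      moreover have "Re (\<omega> - \<tau>) = Re \<omega> - Re \<tau>" "Im (\<omega> - \<tau>) = Im \<omega> - Im \<tau>" by simp_all
      ultimately have "Re \<omega> + Im \<omega> \<ge> norm \<tau> / 2 - 2" using s\<tau> by linarith
      moreover have "norm \<tau> / 2 > \<bar>M\<bar> + 2"
        using \<tau>(2) \<open>0 \<le> C\<close> abs_Im_le_cmod[of \<tau>] unfolding K_def by linarith
      ultimately show ?thesis unfolding \<Omega>_def by simp
    qed
    have "\<exists>!\<omega>\<in>S. \<tau> - (L \<omega> - \<omega>) = \<omega>"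
    proof (rule Banach_fix[of S "1/400"])
      show "complete S" by (simp add: S_def complete_eq_closed)
      show "S \<noteq> {}" by (simp add: S_def)
      show "(\<lambda>\<omega>. \<tau> - (L \<omega> - \<omega>)) ` S \<subseteq> S"
      proof safe
        fix \<omega> assume \<omega>: "\<omega> \<in> S"
        have "norm (\<omega> - \<omega>0) \<le> norm (\<omega> - \<tau>) + norm (\<tau> - \<omega>0)"
          using norm_triangle_ineq[of "\<omega> - \<tau>" "\<tau> - \<omega>0"] by simp
        moreover have "norm (\<omega> - \<tau>) \<le> norm \<tau> / 4"
          using \<omega> by (simp add: S_def dist_norm norm_minus_commute)
        moreover have "norm (\<tau> - \<omega>0) \<le> norm \<tau> + norm \<omega>0" by (rule norm_triangle_ineq4)
        ultimately have 1: "norm (\<omega> - \<omega>0) \<le> norm \<omega>0 + norm \<tau> + norm \<tau> / 4" by linarith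
        have 2: "norm (L \<omega> - \<omega>) \<le> norm (L \<omega>0 - \<omega>0) + norm ((L \<omega> - \<omega>) - (L \<omega>0 - \<omega>0))"
          by (rule norm_triangle_sub)
        have "norm (L \<omega> - \<omega>) \<le> C + 1/10 * norm \<tau>"
          using 1 2 lip[OF S\<Omega>[OF \<omega>] \<omega>0] norm_ge_zero[of \<omega>0] norm_ge_zero[of \<tau>]
          unfolding C_def by linarith
        moreover have "C \<le> norm \<tau> / 8"
          using n\<tau> unfolding K_def by linarith
        ultimately have "norm (L \<omega> - \<omega>) \<le> norm \<tau> / 4" using norm_ge_zero[of \<tau>] by linarith
        then show "\<tau> - (L \<omega> - \<omega>) \<in> S" by (simp add: S_def dist_norm)
      qed
      show "dist (\<tau> - (L x - x)) (\<tau> - (L y - y)) \<le> 1/400 * dist x y" if "x \<in> S" "y \<in> S" for x y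
        using lip[OF S\<Omega>[OF that(1)] S\<Omega>[OF that(2)]]
        by (simp add: dist_norm norm_minus_commute algebra_simps)
    qed auto
    then obtain \<omega> where \<omega>: "\<omega> \<in> S" "\<tau> - (L \<omega> - \<omega>) = \<omega>" by blast
    then have "L \<omega> = \<tau>" by (simp add: algebra_simps)
    with \<omega>(1) show ?thesis
      using S\<Omega>[OF \<omega>(1)] by (auto simp: S_def dist_norm norm_minus_commute)
  qed
  obtain Q where Q: "Q holomorphic_on (L ` \<Omega>)" "\<And>z. z \<in> \<Omega> \<Longrightarrow> deriv L z * deriv Q (L z) = 1"
    "\<And>z. z \<in> \<Omega> \<Longrightarrow> Q (L z) = z"
    using holomorphic_has_inverse[OF hol \<Omega>(1) inj] by blast
  have op: "open (L ` \<Omega>)" by (rule open_mapping_thm3[OF hol \<Omega>(1) inj])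
  show ?thesis
  proof (intro exI[of _ Q] exI[of _ K] allI impI)
    fix \<tau> assume \<tau>: "-1 < Re \<tau>" "K < Im \<tau>"
    obtain \<omega> where \<omega>: "\<omega> \<in> \<Omega>" "L \<omega> = \<tau>" "norm (\<omega> - \<tau>) \<le> norm \<tau> / 4"
      using surj[OF \<tau>] by blast
    then have inv: "Q \<tau> \<in> \<Omega>" "L (Q \<tau>) = \<tau>" "norm (Q \<tau> - \<tau>) \<le> norm \<tau> / 4"
      using Q(3)[OF \<omega>(1)] by auto
    have der: "(Q has_field_derivative deriv Q \<tau>) (at \<tau>)"
      using \<omega> by (intro holomorphic_derivI[OF Q(1) op]) auto
    have 1: "deriv L \<omega> * deriv Q \<tau> = 1" using Q(2)[OF \<omega>(1)] \<omega>(2) by simp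
    define d where "d = deriv L \<omega> - 1"
    have d: "norm d \<le> 1/400" using dL[OF \<omega>(1)] by (simp add: d_def)
    have eq: "deriv Q \<tau> - 1 = - d * (deriv Q \<tau> - 1) - d"
      using 1 by (simp add: d_def algebra_simps)
    have "norm (deriv Q \<tau> - 1) \<le> norm (- d * (deriv Q \<tau> - 1)) + norm d"
      by (subst eq) (rule norm_triangle_ineq4)
    also have "\<dots> = norm d * norm (deriv Q \<tau> - 1) + norm d"
      by (simp only: norm_mult norm_minus_cancel)
    also have "\<dots> \<le> 1/400 * norm (deriv Q \<tau> - 1) + 1/400"
      using d by (intro add_mono mult_right_mono) auto
    finally have "norm (deriv Q \<tau> - 1) \<le> 1/200" by simp
    with inv der show "Q \<tau> \<in> \<Omega> \<and> L (Q \<tau>) = \<tau> \<and> norm (Q \<tau> - \<tau>) \<le> norm \<tau> / 4 \<and>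
        (Q has_field_derivative deriv Q \<tau>) (at \<tau>) \<and> norm (deriv Q \<tau> - 1) \<le> 1/200"
      by blast
  qed
qed

section \<open>The logarithmic coordinate\<close>

text \<open>
  The principal branch of the \<open>n\<close>-th root, used away from the nonpositive reals. Its value is
  never 0, not even at \<open>\<omega> = 0\<close>, since it is defined through the exponential.
\<close>

definition principal_root :: "nat \<Rightarrow> complex \<Rightarrow> complex" where
  "principal_root n \<omega> = exp (Ln \<omega> / of_nat n)"

lemma principal_root_power: "n \<noteq> 0 \<Longrightarrow> \<omega> \<noteq> 0 \<Longrightarrow> principal_root n \<omega> ^ n = \<omega>"
  by (simp add: principal_root_def flip: exp_of_nat_mult)

lemma norm_principal_root: "\<omega> \<noteq> 0 \<Longrightarrow> norm (principal_root n \<omega>) = norm \<omega> powr (1 / n)"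
  by (simp add: principal_root_def powr_def)

lemma has_field_derivative_principal_root:
  assumes "1 \<le> n" "\<omega> \<notin> \<real>\<^sub>\<le>\<^sub>0"
  shows "(principal_root n has_field_derivative principal_root n \<omega> / (of_nat n * \<omega>)) (at \<omega>)"
  unfolding principal_root_def[abs_def] using assms
  by (auto intro!: derivative_eq_intros simp: field_simps)

lemma oblique_halfplane_root:
  assumes "1 \<le> n" "1 \<le> R" "2 * R ^ n \<le> Re \<omega> + Im \<omega>"
  shows "\<omega> \<notin> \<real>\<^sub>\<le>\<^sub>0" "\<omega> \<noteq> 0" "1 \<le> norm \<omega>" "R \<le> norm (principal_root n \<omega>)"
    "norm (principal_root n \<omega>) \<le> norm \<omega>"
proof -
  have Rn: "1 \<le> R ^ n" using assms by simp
  have "Re \<omega> \<le> norm \<omega>" "Im \<omega> \<le> norm \<omega>" 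
    using abs_Re_le_cmod[of \<omega>] abs_Im_le_cmod[of \<omega>] by linarith+
  then have w: "R ^ n \<le> norm \<omega>" using assms(3) by linarith
  then show n1: "1 \<le> norm \<omega>" and nz: "\<omega> \<noteq> 0" using Rn by auto
  show "\<omega> \<notin> \<real>\<^sub>\<le>\<^sub>0" 
    using assms(3) Rn by (auto simp: complex_nonpos_Reals_iff)
  have eq: "norm (principal_root n \<omega>) ^ n = norm \<omega>"
    using principal_root_power[of n \<omega>] nz assms(1) by (simp flip: norm_power)
  then show "R \<le> norm (principal_root n \<omega>)"
    using w assms(1) power_less_imp_less_base[of "norm (principal_root n \<omega>)" n R] power_strict_mono[of "norm (principal_root n \<omega>)" R n]
    by (fastforce simp: not_le[symmetric])
  show "norm (principal_root n \<omega>) \<le> norm \<omega>"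
    using n1 nz assms(1) powr_mono[of "1/n" 1 "norm \<omega>"] by (simp add: norm_principal_root)
qed

text \<open>
  The polynomial \<open>p\<close> composed with the \<open>n\<close>-th root has a logarithm of small derivative far out:
  \<open>p'/p\<close> tends to 0 at infinity, and the root has derivative of norm at most 1.
\<close>

lemma poly_root_logarithm:
  fixes p :: "complex poly"
  assumes "p \<noteq> 0" "1 \<le> n" "0 < \<epsilon>"
  obtains R where "1 \<le> R" "\<And>M. 2 * R ^ n \<le> M \<Longrightarrow> \<exists>s s'. \<forall>\<omega>. M < Re \<omega> + Im \<omega> \<longrightarrow>
    exp (s \<omega>) = poly p (principal_root n \<omega>) \<and> (s has_field_derivative s' \<omega>) (at \<omega>) \<and> norm (s' \<omega>) \<le> \<epsilon>"
proof -
  have "((\<lambda>z. poly (pderiv p) z / poly p z) \<longlongrightarrow> 0) at_infinity"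
  proof (cases "degree p = 0")
    case True
    then have "pderiv p = 0" by (simp add: pderiv_eq_0_iff)
    then show ?thesis by simp
  next
    case False
    then show ?thesis by (intro poly_divide_tendsto_0_at_infinity) (simp add: degree_pderiv)
  qed
  from tendstoD[OF this \<open>0 < \<epsilon>\<close>]
  have "\<forall>\<^sub>F z in at_infinity. norm (poly (pderiv p) z / poly p z) < \<epsilon>" by simp
  with poly_subexponential_bounds[OF \<open>p \<noteq> 0\<close> zero_less_one]
  have "\<forall>\<^sub>F z in at_infinity. poly p z \<noteq> 0 \<and> norm (poly (pderiv p) z / poly p z) < \<epsilon>"
    by eventually_elim (auto simp: not_le)
  then obtain b where b: "\<And>z. b \<le> norm z \<Longrightarrow> poly p z \<noteq> 0 \<and> norm (poly (pderiv p) z / poly p z) < \<epsilon>"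
    unfolding eventually_at_infinity by blast
  define R where "R = max 1 b"
  have "1 \<le> R" by (simp add: R_def)
  show ?thesis
  proof (rule that[OF \<open>1 \<le> R\<close>])
    fix M assume M: "2 * R ^ n \<le> M"
    define \<Omega> where "\<Omega> = {\<omega>. M < Re \<omega> + Im \<omega>}"
    note \<Omega> = open_convex_oblique_halfplane[of M, folded \<Omega>_def]
    have root: "\<omega> \<notin> \<real>\<^sub>\<le>\<^sub>0" "\<omega> \<noteq> 0" "1 \<le> norm \<omega>" "R \<le> norm (principal_root n \<omega>)"
      "norm (principal_root n \<omega>) \<le> norm \<omega>" if "\<omega> \<in> \<Omega>" for \<omega>
      using oblique_halfplane_root[OF \<open>1 \<le> n\<close> \<open>1 \<le> R\<close>, of \<omega>] that M by (auto simp: \<Omega>_def)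
    have bR: "poly p (principal_root n \<omega>) \<noteq> 0"
      "norm (poly (pderiv p) (principal_root n \<omega>) / poly p (principal_root n \<omega>)) < \<epsilon>" if "\<omega> \<in> \<Omega>" for \<omega>
      using b[of "principal_root n \<omega>"] root(4)[OF that] by (auto simp: R_def)
    define g' where "g' \<omega> = poly (pderiv p) (principal_root n \<omega>) * (principal_root n \<omega> / (of_nat n * \<omega>))" for \<omega>
    have dg: "((\<lambda>\<omega>. poly p (principal_root n \<omega>)) has_field_derivative g' \<omega>) (at \<omega>)" if "\<omega> \<in> \<Omega>" for \<omega>
      unfolding g'_def
      by (rule DERIV_chain2[OF poly_DERIV has_field_derivative_principal_root[OF \<open>1 \<le> n\<close> root(1)[OF that]]])
    then have hol: "(\<lambda>\<omega>. poly p (principal_root n \<omega>)) holomorphic_on \<Omega>"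
      using \<Omega>(1) by (auto simp: holomorphic_on_open)
    have "of_real (\<bar>M\<bar> + 1) \<in> \<Omega>" by (simp add: \<Omega>_def)
    then obtain s where s: "s holomorphic_on \<Omega>" "\<And>\<omega>. \<omega> \<in> \<Omega> \<Longrightarrow> exp (s \<omega>) = poly p (principal_root n \<omega>)"
      using holomorphic_logarithm_exists[OF \<Omega>(2,1) hol bR(1)] by blast
    have "(s has_field_derivative deriv s \<omega>) (at \<omega>) \<and> norm (deriv s \<omega>) \<le> \<epsilon>" if \<omega>: "\<omega> \<in> \<Omega>" for \<omega>
    proof
      show ds: "(s has_field_derivative deriv s \<omega>) (at \<omega>)"
        by (rule holomorphic_derivI[OF s(1) \<Omega>(1) \<omega>])
      then have "((\<lambda>\<omega>. exp (s \<omega>)) has_field_derivative exp (s \<omega>) * deriv s \<omega>) (at \<omega>)"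
        by (auto intro!: derivative_eq_intros)
      moreover have "((\<lambda>\<omega>. exp (s \<omega>)) has_field_derivative g' \<omega>) (at \<omega>)"
        using dg[OF \<omega>] \<Omega>(1) \<omega> by (rule has_field_derivative_transform_within_open) (simp add: s(2))
      ultimately have "poly p (principal_root n \<omega>) * deriv s \<omega> = g' \<omega>"
        using DERIV_unique s(2)[OF \<omega>] by metis
      then have "deriv s \<omega> = (poly (pderiv p) (principal_root n \<omega>) / poly p (principal_root n \<omega>))
          * (principal_root n \<omega> / (of_nat n * \<omega>))"
        using nonzero_eq_divide_eq[OF bR(1)[OF \<omega>], of "deriv s \<omega>" "g' \<omega>"]
        by (simp add: g'_def mult.commute)
      then have "norm (deriv s \<omega>) = norm (poly (pderiv p) (principal_root n \<omega>) / poly p (principal_root n \<omega>))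
          * norm (principal_root n \<omega> / (of_nat n * \<omega>))"
        by (simp only: norm_mult)
      also have "\<dots> \<le> \<epsilon> * 1"
      proof (intro mult_mono)
        have "norm \<omega> * 1 \<le> norm \<omega> * real n"
          using \<open>1 \<le> n\<close> by (intro mult_left_mono) auto
        then have "norm (principal_root n \<omega>) \<le> real n * norm \<omega>"
          using root(5)[OF \<omega>] by (simp add: mult.commute)
        then show "norm (principal_root n \<omega> / (of_nat n * \<omega>)) \<le> 1"
          using root(2)[OF \<omega>] \<open>1 \<le> n\<close> by (simp add: norm_divide norm_mult divide_le_eq)
      qed (use bR(2)[OF \<omega>] \<open>0 < \<epsilon>\<close> in auto)
      finally show "norm (deriv s \<omega>) \<le> \<epsilon>" by simp
    qed
    with s(2) show "\<exists>s s'. \<forall>\<omega>. M < Re \<omega> + Im \<omega> \<longrightarrow>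
      exp (s \<omega>) = poly p (principal_root n \<omega>) \<and> (s has_field_derivative s' \<omega>) (at \<omega>) \<and> norm (s' \<omega>) \<le> \<epsilon>"
      unfolding \<Omega>_def by blast
  qed
qed

lemma norm_inverse_of_nat_minus_one_le:
  assumes "1 \<le> n"
  shows "norm (1 / complex_of_nat n - 1) \<le> 1"
proof -
  have "1 / complex_of_nat n - 1 = of_real (1 / real n - 1)" by simp
  then have "norm (1 / complex_of_nat n - 1) = \<bar>1 / real n - 1\<bar>" by (simp only: norm_of_real)
  also have "\<dots> \<le> 1" using assms by (auto simp: abs_le_iff field_simps)
  finally show ?thesis .
qed

text \<open>
  In the variable \<open>\<omega> = z\<^sup>n\<close> the form \<open>h dz\<close>, with \<open>h = (p / q) exp (P z)\<close>, becomes
  \<open>exp (L \<omega>) d\<omega>\<close> with \<open>L' \<close> close to 1.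
\<close>

lemma logarithmic_coordinate:
  fixes P p q :: "complex poly"
  assumes "1 \<le> n" "degree P = n" "lead_coeff P = 1" "p \<noteq> 0" "q \<noteq> 0"
  obtains R where "1 \<le> R" "\<And>M. 2 * R ^ n \<le> M \<Longrightarrow> \<exists>L L'. \<forall>\<omega>. M < Re \<omega> + Im \<omega> \<longrightarrow>
    exp (L \<omega>) = poly p (principal_root n \<omega>) / poly q (principal_root n \<omega>) * exp (poly P (principal_root n \<omega>))
      * (principal_root n \<omega> / (of_nat n * \<omega>)) \<and>
    (L has_field_derivative L' \<omega>) (at \<omega>) \<and> norm (L' \<omega> - 1) \<le> 1/400"
proof -
  let ?r = "principal_root n"
  have cancel: "\<rho> / (of_nat n * \<omega>) = 1 / \<rho> ^ m / of_nat n" if "\<rho> \<noteq> 0" "\<omega> = \<rho> * \<rho> ^ m" for \<rho> \<omega> :: complex and m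
    using that by simp
  have \<epsilon>: "0 < (1/1600 :: real)" by simp
  obtain R1 where R1: "1 \<le> R1" "\<And>M. 2 * R1 ^ n \<le> M \<Longrightarrow> \<exists>s s'. \<forall>\<omega>. M < Re \<omega> + Im \<omega> \<longrightarrow>
    exp (s \<omega>) = poly p (?r \<omega>) \<and> (s has_field_derivative s' \<omega>) (at \<omega>) \<and> norm (s' \<omega>) \<le> 1/1600"
    by (rule poly_root_logarithm[OF \<open>p \<noteq> 0\<close> \<open>1 \<le> n\<close> \<epsilon>]) blast
  obtain R2 where R2: "1 \<le> R2" "\<And>M. 2 * R2 ^ n \<le> M \<Longrightarrow> \<exists>s s'. \<forall>\<omega>. M < Re \<omega> + Im \<omega> \<longrightarrow>
    exp (s \<omega>) = poly q (?r \<omega>) \<and> (s has_field_derivative s' \<omega>) (at \<omega>) \<and> norm (s' \<omega>) \<le> 1/1600"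
    by (rule poly_root_logarithm[OF \<open>q \<noteq> 0\<close> \<open>1 \<le> n\<close> \<epsilon>]) blast
  have "((\<lambda>z. poly (pderiv P) z / z ^ (n - 1)) \<longlongrightarrow> of_nat n) at_infinity"
    using poly_divide_tendsto_aux[of "pderiv P"] assms(1-3)
    by (simp add: degree_pderiv coeff_pderiv)
  then have "((\<lambda>z. poly (pderiv P) z / z ^ (n - 1) / of_nat n) \<longlongrightarrow> of_nat n / of_nat n) at_infinity"
    by (rule tendsto_divide) (use \<open>1 \<le> n\<close> in auto)
  from tendstoD[OF this, of "1/1600"]
  have "\<forall>\<^sub>F z in at_infinity. norm (poly (pderiv P) z / z ^ (n - 1) / of_nat n - 1) < 1/1600"
    using \<open>1 \<le> n\<close> by (simp add: dist_norm)
  then obtain b where b: "\<And>z. b \<le> norm z \<Longrightarrow> norm (poly (pderiv P) z / z ^ (n - 1) / of_nat n - 1) < 1/1600"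
    unfolding eventually_at_infinity by blast
  define R where "R = max (max R1 R2) (max b 1600)"
  have R: "1 \<le> R" "R1 \<le> R" "R2 \<le> R" "b \<le> R" "1600 \<le> R" by (auto simp: R_def)
  show ?thesis
  proof (rule that[OF R(1)])
    fix M assume M: "2 * R ^ n \<le> M"
    have "R1 ^ n \<le> R ^ n" "R2 ^ n \<le> R ^ n"
      using R R1(1) R2(1) by (auto intro!: power_mono)
    then have M1: "2 * R1 ^ n \<le> M" and M2: "2 * R2 ^ n \<le> M" using M by linarith+
    from R1(2)[OF M1] obtain sp sp' where
      *: "\<forall>\<omega>. M < Re \<omega> + Im \<omega> \<longrightarrow> exp (sp \<omega>) = poly p (?r \<omega>) \<and>
        (sp has_field_derivative sp' \<omega>) (at \<omega>) \<and> norm (sp' \<omega>) \<le> 1/1600"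
      by blast
    then have sp: "exp (sp \<omega>) = poly p (?r \<omega>)" "(sp has_field_derivative sp' \<omega>) (at \<omega>)" "norm (sp' \<omega>) \<le> 1/1600"
      if "M < Re \<omega> + Im \<omega>" for \<omega>
      using that by blast+
    from R2(2)[OF M2] obtain sq sq' where
      *: "\<forall>\<omega>. M < Re \<omega> + Im \<omega> \<longrightarrow> exp (sq \<omega>) = poly q (?r \<omega>) \<and>
        (sq has_field_derivative sq' \<omega>) (at \<omega>) \<and> norm (sq' \<omega>) \<le> 1/1600"
      by blast
    then have sq: "exp (sq \<omega>) = poly q (?r \<omega>)" "(sq has_field_derivative sq' \<omega>) (at \<omega>)" "norm (sq' \<omega>) \<le> 1/1600"
      if "M < Re \<omega> + Im \<omega>" for \<omega>
      using that by blast+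
    define \<alpha> where "\<alpha> = 1 / complex_of_nat n - 1"
    \<comment> \<open>The last bracket is the logarithm of the derivative of the root.\<close>
    define L where "L \<omega> = poly P (?r \<omega>) + (sp \<omega> - sq \<omega>) + (\<alpha> * Ln \<omega> - Ln (of_nat n))" for \<omega>
    define L' where "L' \<omega> = poly (pderiv P) (?r \<omega>) * (?r \<omega> / (of_nat n * \<omega>)) + (sp' \<omega> - sq' \<omega>) + \<alpha> * (1 / \<omega>)" for \<omega>
    have "exp (L \<omega>) = poly p (?r \<omega>) / poly q (?r \<omega>) * exp (poly P (?r \<omega>)) * (?r \<omega> / (of_nat n * \<omega>)) \<and>
      (L has_field_derivative L' \<omega>) (at \<omega>) \<and> norm (L' \<omega> - 1) \<le> 1/400" if \<omega>: "M < Re \<omega> + Im \<omega>" for \<omega>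
    proof (intro conjI)
      note root = oblique_halfplane_root[OF \<open>1 \<le> n\<close> R(1), of \<omega>]
      have nz: "\<omega> \<notin> \<real>\<^sub>\<le>\<^sub>0" "\<omega> \<noteq> 0" "1 \<le> norm \<omega>" "R \<le> norm (?r \<omega>)" "norm (?r \<omega>) \<le> norm \<omega>"
        using root \<omega> M by auto
      have "exp (\<alpha> * Ln \<omega>) = ?r \<omega> / \<omega>"
        using nz(2) by (simp add: \<alpha>_def principal_root_def left_diff_distrib exp_diff)
      then have "exp (\<alpha> * Ln \<omega> - Ln (of_nat n)) = ?r \<omega> / (of_nat n * \<omega>)"
        using \<open>1 \<le> n\<close> exp_Ln[of "of_nat n"] unfolding exp_diff by (simp del: Ln_of_nat)
      then show "exp (L \<omega>) = poly p (?r \<omega>) / poly q (?r \<omega>) * exp (poly P (?r \<omega>)) * (?r \<omega> / (of_nat n * \<omega>))"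
        unfolding L_def exp_add[of "_ + _"] exp_add[of "poly _ _"] exp_diff[of "sp _"] sp(1)[OF \<omega>] sq(1)[OF \<omega>]
        by (simp only: mult.assoc mult.commute mult.left_commute)
      have dLn: "(Ln has_field_derivative 1 / \<omega>) (at \<omega>)"
        using has_field_derivative_Ln[OF nz(1)] by (simp add: inverse_eq_divide)
      have dP: "((\<lambda>\<omega>. poly P (?r \<omega>)) has_field_derivative poly (pderiv P) (?r \<omega>) * (?r \<omega> / (of_nat n * \<omega>))) (at \<omega>)"
        by (rule DERIV_chain2[OF poly_DERIV has_field_derivative_principal_root[OF \<open>1 \<le> n\<close> nz(1)]])
      have "((\<lambda>\<omega>. \<alpha> * Ln \<omega> - Ln (of_nat n)) has_field_derivative \<alpha> * (1 / \<omega>) - 0) (at \<omega>)"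
        by (intro DERIV_diff DERIV_cmult dLn DERIV_const)
      from DERIV_add[OF DERIV_add[OF dP DERIV_diff[OF sp(2)[OF \<omega>] sq(2)[OF \<omega>]]] this]
      show "(L has_field_derivative L' \<omega>) (at \<omega>)"
        unfolding L_def[abs_def] L'_def by simp
      have "poly (pderiv P) (?r \<omega>) * (?r \<omega> / (of_nat n * \<omega>)) = poly (pderiv P) (?r \<omega>) / ?r \<omega> ^ (n - 1) / of_nat n"
      proof -
        have "?r \<omega> \<noteq> 0" by (simp add: principal_root_def)
        moreover have "\<omega> = ?r \<omega> * ?r \<omega> ^ (n - 1)"
          using principal_root_power[of n \<omega>] nz(2) \<open>1 \<le> n\<close> by (simp flip: power_Suc)
        ultimately have "?r \<omega> / (of_nat n * \<omega>) = 1 / ?r \<omega> ^ (n - 1) / of_nat n"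
          using cancel[of "?r \<omega>" \<omega> "n - 1"] by blast
        then show ?thesis by simp
      qed
      then have 1: "norm (poly (pderiv P) (?r \<omega>) * (?r \<omega> / (of_nat n * \<omega>)) - 1) \<le> 1/1600"
        using b[of "?r \<omega>"] nz(4) R(4) by simp
      have "norm \<alpha> \<le> 1"
        unfolding \<alpha>_def by (rule norm_inverse_of_nat_minus_one_le[OF \<open>1 \<le> n\<close>])
      then have "norm (\<alpha> * (1 / \<omega>)) \<le> 1 * (1 / 1600)"
        unfolding norm_mult norm_divide using nz(4,5) R(5) by (intro mult_mono frac_le) auto
      then have 4: "norm (\<alpha> * (1 / \<omega>)) \<le> 1/1600" by simp
      have 2: "norm (sp' \<omega> - sq' \<omega>) \<le> 1/1600 + 1/1600"
        using sp(3)[OF \<omega>] sq(3)[OF \<omega>] norm_triangle_ineq4[of "sp' \<omega>" "sq' \<omega>"] by linarith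
      have "L' \<omega> - 1 = (poly (pderiv P) (?r \<omega>) * (?r \<omega> / (of_nat n * \<omega>)) - 1) + (sp' \<omega> - sq' \<omega>) + \<alpha> * (1 / \<omega>)"
        by (simp add: L'_def)
      then have "norm (L' \<omega> - 1) \<le> norm (poly (pderiv P) (?r \<omega>) * (?r \<omega> / (of_nat n * \<omega>)) - 1) + norm (sp' \<omega> - sq' \<omega>) + norm (\<alpha> * (1 / \<omega>))"
        by (simp only:) (intro norm_triangle_mono order_refl)
      with 1 2 4 show "norm (L' \<omega> - 1) \<le> 1/400" by linarith
    qed
    then show "\<exists>L L'. \<forall>\<omega>. M < Re \<omega> + Im \<omega> \<longrightarrow>
      exp (L \<omega>) = poly p (?r \<omega>) / poly q (?r \<omega>) * exp (poly P (?r \<omega>)) * (?r \<omega> / (of_nat n * \<omega>)) \<and>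
      (L has_field_derivative L' \<omega>) (at \<omega>) \<and> norm (L' \<omega> - 1) \<le> 1/400"
      by blast
  qed
qed

section \<open>Double exponential growth of solutions\<close>

text \<open>
  Suppose \<open>f\<close> is bounded by \<open>exp (exp (|z|\<^sup>c))\<close> near infinity. With \<open>\<tau> = L \<omega>\<close> as independent
  variable, inverse function \<open>Q\<close>, and after division of \<open>f\<close> by the derivative \<open>1 / w\<close> of the root at
  \<open>\<omega>\<close>, the differential equation takes the form required by \<open>strip_growth\<close>. As \<open>|z|\<^sup>c\<close> is at most
  a constant multiple of a power of \<open>|\<tau>|\<close> with exponent \<open>c / n < 1\<close>, the growth hypothesis of that lemma holds as well.
\<close>

lemma linear_ode_frequently_large:
  fixes P p q :: "complex poly" and f h :: "complex \<Rightarrow> complex"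
  assumes n: "1 \<le> n" and P: "degree P = n" "lead_coeff P = 1" and pq: "p \<noteq> 0" "q \<noteq> 0"
    and h: "\<And>z. h z = poly p z / poly q z * exp (poly P z)"
    and ode: "\<And>z. R0 < norm z \<Longrightarrow> (f has_field_derivative h z * f z + 1) (at z)"
    and c: "0 < c" "c < real n"
  shows "\<exists>\<^sub>F z in at_infinity. exp (exp (norm z powr c)) < norm (f z)"
  unfolding frequently_def
proof
  assume "\<forall>\<^sub>F z in at_infinity. \<not> exp (exp (norm z powr c)) < norm (f z)"
  then obtain b where b: "\<And>z. b \<le> norm z \<Longrightarrow> norm (f z) \<le> exp (exp (norm z powr c))"
    unfolding eventually_at_infinity by (auto simp: not_less)
  let ?r = "principal_root n"
  obtain R1 where R1: "1 \<le> R1" "\<And>M. 2 * R1 ^ n \<le> M \<Longrightarrow> \<exists>L L'. \<forall>\<omega>. M < Re \<omega> + Im \<omega> \<longrightarrow>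
    exp (L \<omega>) = poly p (?r \<omega>) / poly q (?r \<omega>) * exp (poly P (?r \<omega>)) * (?r \<omega> / (of_nat n * \<omega>)) \<and>
    (L has_field_derivative L' \<omega>) (at \<omega>) \<and> norm (L' \<omega> - 1) \<le> 1/400"
    by (rule logarithmic_coordinate[OF n P pq]) blast
  define R where "R = max R1 (max b (R0 + 1))"
  have R: "1 \<le> R" "R1 \<le> R" "b \<le> R" "R0 < R" using R1(1) by (auto simp: R_def)
  define M where "M = 2 * R ^ n"
  have "2 * R1 ^ n \<le> M"
    unfolding M_def using R R1(1) by (auto intro!: power_mono)
  from R1(2)[OF this] obtain L L' where
    *: "\<forall>\<omega>. M < Re \<omega> + Im \<omega> \<longrightarrow> exp (L \<omega>) = poly p (?r \<omega>) / poly q (?r \<omega>) * exp (poly P (?r \<omega>)) * (?r \<omega> / (of_nat n * \<omega>)) \<and>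
    (L has_field_derivative L' \<omega>) (at \<omega>) \<and> norm (L' \<omega> - 1) \<le> 1/400"
    by blast
  define \<Omega> where "\<Omega> = {\<omega>. M < Re \<omega> + Im \<omega>}"
  have L: "exp (L \<omega>) = h (?r \<omega>) * (?r \<omega> / (of_nat n * \<omega>))" "(L has_field_derivative L' \<omega>) (at \<omega>)"
    "norm (L' \<omega> - 1) \<le> 1/400" if "\<omega> \<in> \<Omega>" for \<omega>
    using * that by (auto simp: \<Omega>_def h)
  have root: "\<omega> \<notin> \<real>\<^sub>\<le>\<^sub>0" "\<omega> \<noteq> 0" "1 \<le> norm \<omega>" "R \<le> norm (?r \<omega>)" if "\<omega> \<in> \<Omega>" for \<omega>
    using oblique_halfplane_root[OF n R(1), of \<omega>] that by (auto simp: \<Omega>_def M_def)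
  have holL: "L holomorphic_on \<Omega>"
    using open_convex_oblique_halfplane(1)[of M] L(2) by (auto simp: holomorphic_on_open \<Omega>_def)
  have dL: "norm (deriv L \<omega> - 1) \<le> 1/400" if "\<omega> \<in> \<Omega>" for \<omega>
    using L(2,3)[OF that] DERIV_imp_deriv by metis
  obtain Q K where inv: "\<forall>\<tau>. -1 < Re \<tau> \<longrightarrow> K < Im \<tau> \<longrightarrow>
      Q \<tau> \<in> \<Omega> \<and> L (Q \<tau>) = \<tau> \<and> norm (Q \<tau> - \<tau>) \<le> norm \<tau> / 4 \<and>
      (Q has_field_derivative deriv Q \<tau>) (at \<tau>) \<and> norm (deriv Q \<tau> - 1) \<le> 1/200"
    using near_identity_inverse[of L M, folded \<Omega>_def, OF holL dL] by blast
  have Q: "Q \<tau> \<in> \<Omega> \<and> L (Q \<tau>) = \<tau> \<and> norm (Q \<tau> - \<tau>) \<le> norm \<tau> / 4"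
    and dQ: "(Q has_field_derivative deriv Q \<tau>) (at \<tau>)"
    and dQ1: "norm (deriv Q \<tau> - 1) \<le> 1/200" if "-1 < Re \<tau>" "K < Im \<tau>" for \<tau>
    using inv that by blast+
  \<comment> \<open>A vertical shift by a multiple of \<open>2\<pi>\<i>\<close>, which leaves \<open>exp\<close> unchanged, puts the half-strip into the domain of \<open>Q\<close>; the bound 1000 makes the error term in \<open>A\<close> small.\<close>
  define k where "k = nat \<lceil>max K 1000 + 1\<rceil>"
  define y0 where "y0 = 2 * pi * real k"
  have "max K 1000 + 1 \<le> real k" unfolding k_def by (rule real_nat_ceiling_ge)
  moreover have "real k * 1 \<le> real k * (2 * pi)" using pi_gt3 by (intro mult_left_mono) auto
  ultimately have y0: "K + 1 \<le> y0" "1001 \<le> y0" unfolding y0_def by (auto simp: mult.commute)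
  define p0 where "p0 = complex_of_real y0 * \<i>"
  have expp0: "exp p0 = 1"
    by (simp add: p0_def y0_def exp_eq_polar cis_multiple_2pi)
  define T where "T = {\<tau>. -1 < Re \<tau> \<and> -1 < Im \<tau> \<and> Im \<tau> < (7::real)}"
  have T: "-1 < Re (\<tau> + p0)" "K < Im (\<tau> + p0)" "1000 < Im (\<tau> + p0)" if "\<tau> \<in> T" for \<tau>
    using that y0 by (auto simp: T_def p0_def)
  define \<alpha> where "\<alpha> = 1 / complex_of_nat n - 1"
  have \<alpha>: "norm \<alpha> \<le> 1"
    unfolding \<alpha>_def by (rule norm_inverse_of_nat_minus_one_le[OF n])
  define q0 where "q0 \<tau> = Q (\<tau> + p0)" for \<tau>
  define q1 where "q1 \<tau> = deriv Q (\<tau> + p0)" for \<tau>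
  \<comment> \<open>The reciprocal of the derivative of the root at \<open>q0 \<tau>\<close>.\<close>
  define w where "w \<tau> = of_nat n * q0 \<tau> / ?r (q0 \<tau>)" for \<tau>
  define y where "y \<tau> = f (?r (q0 \<tau>)) * w \<tau>" for \<tau>
  define A where "A \<tau> = q1 \<tau> - \<alpha> * q1 \<tau> / q0 \<tau> * exp (- \<tau>)" for \<tau>
  have q\<Omega>: "q0 \<tau> \<in> \<Omega>" "L (q0 \<tau>) = \<tau> + p0" "norm (q0 \<tau> - (\<tau> + p0)) \<le> norm (\<tau> + p0) / 4" if "\<tau> \<in> T" for \<tau>
    using Q[OF T(1,2)[OF that]] by (auto simp: q0_def)
  have q0_big: "750 \<le> norm (q0 \<tau>)" if "\<tau> \<in> T" for \<tau>
  proof -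
    have "1000 \<le> norm (\<tau> + p0)" using T(3)[OF that] abs_Im_le_cmod[of "\<tau> + p0"] by linarith
    moreover have "norm (\<tau> + p0) \<le> norm (q0 \<tau>) + norm (q0 \<tau> - (\<tau> + p0))"
      by (metis norm_minus_commute norm_triangle_sub)
    ultimately show ?thesis using q\<Omega>(3)[OF that] by linarith
  qed
  have q1_1: "norm (q1 \<tau> - 1) \<le> 1/200" if "\<tau> \<in> T" for \<tau>
    using dQ1[OF T(1,2)[OF that]] by (simp add: q1_def)
  have dq0: "(q0 has_field_derivative q1 \<tau>) (at \<tau>)" if "\<tau> \<in> T" for \<tau>
  proof -
    have "((\<lambda>\<tau>. \<tau> + p0) has_field_derivative 1) (at \<tau>)" by (auto intro!: derivative_eq_intros)
    from DERIV_chain2[OF dQ[OF T(1,2)[OF that]] this] show ?thesis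
      by (simp add: q0_def[abs_def] q1_def)
  qed
  have dr: "((\<lambda>\<tau>. ?r (q0 \<tau>)) has_field_derivative ?r (q0 \<tau>) / (of_nat n * q0 \<tau>) * q1 \<tau>) (at \<tau>)" if "\<tau> \<in> T" for \<tau>
    by (rule DERIV_chain2[OF has_field_derivative_principal_root[OF n root(1)[OF q\<Omega>(1)[OF that]]] dq0[OF that]])
  have rnz: "?r \<omega> \<noteq> 0" for \<omega> by (simp add: principal_root_def)
  have qnz: "q0 \<tau> \<noteq> 0" if "\<tau> \<in> T" for \<tau> using root(2)[OF q\<Omega>(1)[OF that]] .
  have dw: "(w has_field_derivative - \<alpha> * q1 \<tau> / q0 \<tau> * w \<tau>) (at \<tau>)" if "\<tau> \<in> T" for \<tau>
    unfolding w_def[abs_def] \<alpha>_def using rnz qnz[OF that] n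
    by (auto intro!: derivative_eq_intros dq0 dr that simp: field_simps)
  have dy: "(y has_field_derivative A \<tau> * exp \<tau> * y \<tau> + q1 \<tau>) (at \<tau>)" if \<tau>: "\<tau> \<in> T" for \<tau>
  proof -
    let ?z = "?r (q0 \<tau>)"
    have "R0 < norm ?z" using root(4)[OF q\<Omega>(1)[OF \<tau>]] R(4) by linarith
    from DERIV_mult[OF DERIV_chain2[OF ode[OF this] dr[OF \<tau>]] dw[OF \<tau>]]
    have D: "(y has_field_derivative (h ?z * f ?z + 1) * (?z / (of_nat n * q0 \<tau>) * q1 \<tau>) * w \<tau>
        + (- \<alpha> * q1 \<tau> / q0 \<tau> * w \<tau>) * f ?z) (at \<tau>)"
      unfolding y_def[abs_def] .
    have unit: "?z / (of_nat n * q0 \<tau>) * w \<tau> = 1"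
      using rnz qnz[OF \<tau>] n by (simp add: w_def)
    have hz: "h ?z * (?z / (of_nat n * q0 \<tau>)) = exp \<tau>"
      using L(1)[OF q\<Omega>(1)[OF \<tau>]] q\<Omega>(2)[OF \<tau>] expp0 by (simp add: exp_add)
    have "(h ?z * f ?z + 1) * (?z / (of_nat n * q0 \<tau>) * q1 \<tau>) * w \<tau>
        = (h ?z * (?z / (of_nat n * q0 \<tau>))) * (f ?z * w \<tau>) * q1 \<tau> + (?z / (of_nat n * q0 \<tau>) * w \<tau>) * q1 \<tau>"
      by (simp only: ring_distribs mult.assoc mult.commute mult.left_commute mult_1_left mult_1_right)
    also have "\<dots> = exp \<tau> * y \<tau> * q1 \<tau> + q1 \<tau>"
      unfolding unit hz by (simp add: y_def)
    finally have e1: "(h ?z * f ?z + 1) * (?z / (of_nat n * q0 \<tau>) * q1 \<tau>) * w \<tau> = exp \<tau> * y \<tau> * q1 \<tau> + q1 \<tau>" .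
    have "exp (- \<tau>) * exp \<tau> = 1" by (simp flip: exp_add)
    then have e2: "A \<tau> * exp \<tau> = q1 \<tau> * exp \<tau> - \<alpha> * q1 \<tau> / q0 \<tau>"
      unfolding A_def left_diff_distrib mult.assoc[of "\<alpha> * q1 \<tau> / q0 \<tau>"] by simp
    show ?thesis
      using D unfolding e1 e2 by (simp add: y_def algebra_simps)
  qed
  have hol: "A holomorphic_on T"
  proof -
    have oT: "open T"
      unfolding T_def by (rule open_convex_half_strip)
    have q0h: "q0 holomorphic_on T" using oT dq0 by (auto simp: holomorphic_on_open)
    have "deriv q0 holomorphic_on T" by (rule holomorphic_deriv[OF q0h oT])
    then have "q1 holomorphic_on T"
      by (rule holomorphic_transform) (use dq0 DERIV_imp_deriv in blast)
    then show ?thesis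
      unfolding A_def[abs_def] using q0h qnz by (intro holomorphic_intros) auto
  qed
  have A1: "norm (A \<tau> - 1) \<le> 1/100" if \<tau>: "\<tau> \<in> T" for \<tau>
  proof -
    have "norm (q1 \<tau>) \<le> 1 + 1/200"
      using q1_1[OF \<tau>] norm_triangle_sub[of "q1 \<tau>" 1] by simp
    moreover have "norm (exp (- \<tau>)) \<le> 3"
    proof -
      have "norm (exp (- \<tau>)) \<le> exp 1" using \<tau> by (simp add: T_def)
      also have "\<dots> \<le> 3" by (rule exp_le)
      finally show ?thesis .
    qed
    ultimately have "norm (\<alpha> * q1 \<tau> / q0 \<tau> * exp (- \<tau>)) \<le> 1 * (1 + 1/200) / 750 * 3"
      unfolding norm_mult norm_divide using \<alpha> q0_big[OF \<tau>] by (intro mult_mono frac_le) auto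
    also have "\<dots> \<le> 1/250 + 1/1000" by simp
    finally have small: "norm (\<alpha> * q1 \<tau> / q0 \<tau> * exp (- \<tau>)) \<le> 1/250 + 1/1000" .
    have "A \<tau> - 1 = (q1 \<tau> - 1) - \<alpha> * q1 \<tau> / q0 \<tau> * exp (- \<tau>)" by (simp add: A_def)
    then have "norm (A \<tau> - 1) \<le> norm (q1 \<tau> - 1) + norm (\<alpha> * q1 \<tau> / q0 \<tau> * exp (- \<tau>))"
      by (simp only: norm_triangle_ineq4)
    then show ?thesis using small q1_1[OF \<tau>] by linarith
  qed
  have B1: "norm (q1 \<tau> - 1) \<le> 1/100" if \<tau>: "\<tau> \<in> T" for \<tau>
    using q1_1[OF \<tau>] by linarith
  define a where "a = c / n"
  have a: "0 < a" "a < 1" using c by (auto simp: a_def)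
  define D where "D = y0 + 7"
  have "0 < D" using y0 by (simp add: D_def)
  have yb: "norm (y \<tau>) \<le> exp (exp ((2 * (t + D)) powr a)) * (real n * (2 * (t + D)))"
    if \<tau>: "\<tau> \<in> T" "Re \<tau> = t" "0 \<le> t" for \<tau> t
  proof -
    let ?\<omega> = "q0 \<tau>"
    note w\<Omega> = q\<Omega>(1)[OF \<tau>(1)]
    have "norm (\<tau> + p0) \<le> \<bar>Re (\<tau> + p0)\<bar> + \<bar>Im (\<tau> + p0)\<bar>" by (rule cmod_le)
    also have "\<dots> \<le> t + D" using \<tau> y0 by (auto simp: p0_def T_def D_def)
    finally have tD: "norm (\<tau> + p0) \<le> t + D" .
    have "norm ?\<omega> \<le> norm (\<tau> + p0) + norm (\<tau> + p0) / 4"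
      using q\<Omega>(3)[OF \<tau>(1)] norm_triangle_sub[of ?\<omega> "\<tau> + p0"] by linarith
    also have "\<dots> \<le> 2 * norm (\<tau> + p0)" by simp
    also have "\<dots> \<le> 2 * (t + D)" using tD by simp
    finally have n\<omega>: "norm ?\<omega> \<le> 2 * (t + D)" .
    have "norm (?r ?\<omega>) powr c = norm ?\<omega> powr a"
      using root(2)[OF w\<Omega>] by (simp add: norm_principal_root powr_powr a_def)
    also have "\<dots> \<le> (2 * (t + D)) powr a"
      using n\<omega> a by (intro powr_mono2) auto
    finally have "norm (f (?r ?\<omega>)) \<le> exp (exp ((2 * (t + D)) powr a))"
      using b[of "?r ?\<omega>"] root(4)[OF w\<Omega>] R(3) by (meson exp_le_cancel_iff order_trans)
    moreover have "norm (w \<tau>) \<le> real n * (2 * (t + D))"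
    proof -
      have "norm (w \<tau>) = real n * norm ?\<omega> / norm (?r ?\<omega>)"
        by (simp add: w_def norm_mult norm_divide)
      also have "\<dots> \<le> real n * norm ?\<omega> / 1"
        using root(4)[OF w\<Omega>] R(1) by (intro frac_le) auto
      also have "\<dots> \<le> real n * (2 * (t + D))"
        using n\<omega> by (simp add: mult_left_mono)
      finally show ?thesis .
    qed
    ultimately show ?thesis
      unfolding y_def norm_mult by (intro mult_mono) auto
  qed
  have ev: "\<forall>\<^sub>F t in at_top. exp (exp ((2 * (t + D)) powr a)) * (real n * (2 * (t + D))) \<le> exp (exp (t/2))"
  proof -
    define m where "m = real n"
    have "0 < m" using n by (simp add: m_def)
    then show ?thesis unfolding m_def[symmetric] using a \<open>0 < D\<close> by real_asymp
  qed
  show False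
  proof (rule strip_growth[of A y q1, folded T_def])
    show "\<forall>\<^sub>F t in at_top. norm (y (complex_of_real t)) \<le> exp (exp (t/2))"
      using ev eventually_ge_at_top[of 0]
    proof eventually_elim
      case (elim t)
      then show ?case using yb[of "of_real t" t] by (auto simp: T_def)
    qed
    show "\<forall>\<^sub>F t in at_top. norm (y (2 * pi * \<i> + complex_of_real t)) \<le> exp (exp (t/2))"
      using ev eventually_ge_at_top[of 0]
    proof eventually_elim
      case (elim t)
      have "2 * pi < 7" "-1 < 2 * pi" using pi_approx by auto
      then show ?case using yb[of "2 * pi * \<i> + of_real t" t] elim by (auto simp: T_def)
    qed
  qed (use hol dy A1 B1 in auto)
qed

theorem mainTheorem4:
  fixes n :: nat and P :: "complex poly" and S h f :: "complex \<Rightarrow> complex"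
  assumes "n \<ge> 1"
    and "degree P = n" and "lead_coeff P = 1" and "coeff P (n - 1) = 0"
    and "rational_function S" and "S \<noteq> (\<lambda>z. 0)"
    and "\<And>z. h z = S z * exp (poly P z)"
    and "f nicely_meromorphic_on UNIV"
    and "\<And>z. \<not> is_pole f z \<Longrightarrow> \<not> is_pole h z \<Longrightarrow> deriv f z = h z * f z + 1"
  shows "growth_order f = \<infinity> \<and> hyper_order f = growth_order h \<and> growth_order h = ereal (real n)"
proof -
  obtain p q :: "complex poly" where q: "q \<noteq> 0" and S: "\<And>z. S z = poly p z / poly q z"
    using assms(5) unfolding rational_function_def by blast
  have p: "p \<noteq> 0"
    using assms(6) S by (auto simp: fun_eq_iff)
  have h: "h z = poly p z / poly q z * exp (poly P z)" for z
    using assms(7) S by simp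
  obtain R where R: "\<And>z. R \<le> norm z \<Longrightarrow> poly q z \<noteq> 0"
    using poly_subexponential_bounds[OF q zero_less_one] unfolding eventually_at_infinity
    by (metis exp_gt_zero linorder_not_le norm_zero)
  have ode: "(f has_field_derivative h z * f z + 1) (at z)" if "R < norm z" for z
  proof (rule nicely_meromorphic_linear_ode[OF assms(8,9)])
    have poly: "poly r analytic_on {z}" for r :: "complex poly"
    proof -
      have "poly r holomorphic_on UNIV"
        using poly_holomorphic_on[of "\<lambda>z. z" UNIV r] by simp
      then show ?thesis
        using analytic_on_open analytic_on_subset open_UNIV subset_UNIV by blast
    qed
    have "(\<lambda>z. poly p z / poly q z * exp (poly P z)) analytic_on {z}"
      using R[of z] that by (intro analytic_intros poly) auto
    then show "h analytic_on {z}" unfolding h[abs_def] .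
  qed
  have n: "0 < real n" "1 \<le> real n" using assms(1) by auto
  have h_upper: "\<forall>\<^sub>F z in at_infinity. norm (h z) \<le> exp (norm z powr c)" if "real n < c" for c
    unfolding h using exp_poly_growth_upper[OF p q, of P c] assms(2) n that by simp
  have h_lower: "\<exists>\<^sub>F z in at_infinity. exp (norm z powr c) < norm (h z)" if "c < real n" for c
    unfolding h using exp_poly_growth_lower[OF p q, of P c] assms(1-3) that by simp
  have f_upper: "\<forall>\<^sub>F z in at_infinity. norm (f z) \<le> exp (exp (norm z powr c))" if "real n < c" for c
  proof (rule linear_ode_upper_bound[OF ode])
    show "1 \<le> (real n + c) / 2" "(real n + c) / 2 < c" using n that by auto
    show "\<forall>\<^sub>F z in at_infinity. norm (h z) \<le> exp (norm z powr ((real n + c) / 2))"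
      using that by (intro h_upper) auto
  qed
  have f_lower: "\<exists>\<^sub>F z in at_infinity. exp (exp (norm z powr c)) < norm (f z)" if "0 < c" "c < real n" for c
    by (rule linear_ode_frequently_large[OF assms(1-3) p q h ode that])
  have "growth_order h = ereal (real n)"
    using growth_order_le[of "real n" h] growth_order_ge[OF n(1), of h] h_upper h_lower by (intro antisym) auto
  moreover have "hyper_order f = ereal (real n)"
    using hyper_order_le[of "real n" f] hyper_order_ge[OF n(1), of f] f_upper f_lower by (intro antisym) auto
  moreover have "growth_order f = \<infinity>"
    using growth_order_eq_infinity[of "1/2" f] f_lower[of "1/2"] n by auto
  ultimately show ?thesis by simp
qed

end
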